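(* Let $r\in\mathbb N\cup\{0\}$ and let $t\in\mathbb Z/r\mathbb Z$ (so $t\in\mathbb Z$ when $r=0$), where for $r\in\mathbb N$ it is assumed that $t\mid r$. Let $H^t_{2n+1}(\mathbb Z/r\mathbb Z)$ be the $t$-variant of the Heisenberg group over $\mathbb Z/r\mathbb Z$ (defined in the context). (i) For $n>1$, $$\mathrm H^2\big(H^t_{2n+1}(\mathbb Z/r\mathbb Z),\mathbb C^\times\big)=\begin{cases}(\mathbb Z/r\mathbb Z)^{2n^2-n-1}\times(\mathbb Z/t\mathbb Z)^{2n+1}, & \text{if } r\in\mathbb N,\\ (\mathbb C^\times)^{2n^2-n-1}\times(\mathbb Z/t\mathbb Z)^{2n}, & \text{if } r=0.\end{cases}$$ (ii) For $r\in(2\mathbb N+1)\cup\{0\}$ (that is, $r$ an odd natural number or $r=0$), $$\mathrm H^2\big(H^t_{3}(\mathbb Z/r\mathbb Z),\mathbb C^\times\big)=\begin{cases}(\mathbb Z/r\mathbb Z)^{2}\times\mathbb Z/t\mathbb Z, & \text{if } r\in(2\mathbb N+1),\\ (\mathbb C^\times)^{2}, & \text{if } r=0.\end{cases}$$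
   Context: Equality of groups means isomorphism of abelian groups; $\mathbb Z/0\mathbb Z=\mathbb Z$. For a commutative ring $R$ with identity, $t\in R$ and $n\ge 1$, the group $H^t_{2n+1}(R)$ is the set $R^{n+1}\oplus R^n$ with multiplication $$(a,b_1,\dots,b_n,c_1,\dots,c_n)(a',b_1',\dots,b_n',c_1',\dots,c_n')=\Big(a+a'+t\sum_{i=1}^n b_i'c_i,\; b_1+b_1',\dots,b_n+b_n',\;c_1+c_1',\dots,c_n+c_n'\Big).$$ All groups are considered as abstract (discrete) groups. $\mathrm H^2(G,\mathbb C^\times)$ is the second cohomology group of $G$ with coefficients in the trivial $G$-module $\mathbb C^\times$ (the Schur multiplier of $G$).
   Formalization: For r=0 the case t=0 is excluded, since there the group is Z^{2n+1}, whose H^2 is (C^×)^{2n^2+n}, which is not isomorphic to the group given by the stated formula (for n>1 or n=1). *)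

theory Defs
  imports Complex_Main "HOL-Algebra.Algebra"
begin

text \<open>
  The \<open>t\<close>-variant of the Heisenberg group over \<open>R\<close>.  The rows \<open>b\<close>, \<open>c\<close> in \<open>R^n\<close> are extensional
  functions on \<open>{1..n}\<close>.
\<close>

definition heisenberg_group ::
    "('a, 'm) ring_scheme \<Rightarrow> 'a \<Rightarrow> nat \<Rightarrow> ('a \<times> (nat \<Rightarrow> 'a) \<times> (nat \<Rightarrow> 'a)) monoid"
  where "heisenberg_group R t n =
    \<lparr>carrier = carrier R \<times> (\<Pi>\<^sub>E i\<in>{1..n}. carrier R) \<times> (\<Pi>\<^sub>E i\<in>{1..n}. carrier R),
     monoid.mult = (\<lambda>(a, b, c) (a', b', c').
       (a \<oplus>\<^bsub>R\<^esub> a' \<oplus>\<^bsub>R\<^esub> t \<otimes>\<^bsub>R\<^esub> (\<Oplus>\<^bsub>R\<^esub>i\<in>{1..n}. b' i \<otimes>\<^bsub>R\<^esub> c i),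
        \<lambda>i\<in>{1..n}. b i \<oplus>\<^bsub>R\<^esub> b' i,
        \<lambda>i\<in>{1..n}. c i \<oplus>\<^bsub>R\<^esub> c' i)),
     one = (\<zero>\<^bsub>R\<^esub>, \<lambda>i\<in>{1..n}. \<zero>\<^bsub>R\<^esub>, \<lambda>i\<in>{1..n}. \<zero>\<^bsub>R\<^esub>)\<rparr>"

text \<open>
  Second cohomology of a group \<open>G\<close> with coefficients in a trivial \<open>G\<close>-module \<open>A\<close> (written
  multiplicatively), by inhomogeneous, not necessarily normalised, cochains.
\<close>

definition cochains2 ::
    "('g, 'k) monoid_scheme \<Rightarrow> ('a, 'm) monoid_scheme \<Rightarrow> ('g \<times> 'g \<Rightarrow> 'a) monoid"
  where "cochains2 G A = product_group (carrier G \<times> carrier G) (\<lambda>_. A)"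

definition cocycles2 ::
    "('g, 'k) monoid_scheme \<Rightarrow> ('a, 'm) monoid_scheme \<Rightarrow> ('g \<times> 'g \<Rightarrow> 'a) set"
  where "cocycles2 G A =
    {f \<in> carrier (cochains2 G A).
       \<forall>x\<in>carrier G. \<forall>y\<in>carrier G. \<forall>z\<in>carrier G.
         f (x, y) \<otimes>\<^bsub>A\<^esub> f (x \<otimes>\<^bsub>G\<^esub> y, z) = f (y, z) \<otimes>\<^bsub>A\<^esub> f (x, y \<otimes>\<^bsub>G\<^esub> z)}"

definition coboundary2 ::
    "('g, 'k) monoid_scheme \<Rightarrow> ('a, 'm) monoid_scheme \<Rightarrow> ('g \<Rightarrow> 'a) \<Rightarrow> 'g \<times> 'g \<Rightarrow> 'a"
  where "coboundary2 G A \<phi> =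
    (\<lambda>(x, y)\<in>carrier G \<times> carrier G. \<phi> x \<otimes>\<^bsub>A\<^esub> \<phi> y \<otimes>\<^bsub>A\<^esub> inv\<^bsub>A\<^esub> \<phi> (x \<otimes>\<^bsub>G\<^esub> y))"

definition coboundaries2 ::
    "('g, 'k) monoid_scheme \<Rightarrow> ('a, 'm) monoid_scheme \<Rightarrow> ('g \<times> 'g \<Rightarrow> 'a) set"
  where "coboundaries2 G A = coboundary2 G A ` (carrier G \<rightarrow> carrier A)"

definition cohomology2 ::
    "('g, 'k) monoid_scheme \<Rightarrow> ('a, 'm) monoid_scheme \<Rightarrow> ('g \<times> 'g \<Rightarrow> 'a) set monoid"
  where "cohomology2 G A = (cochains2 G A)\<lparr>carrier := cocycles2 G A\<rparr> Mod coboundaries2 G A"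

definition complex_units :: "complex monoid"
  where "complex_units = \<lparr>carrier = - {0}, monoid.mult = (*), one = 1\<rparr>"

text \<open>
  \<open>ZFact k\<close> is \<open>\<int>/k\<int>\<close>, hence a copy of \<open>\<int>\<close> (singleton cosets) for \<open>k = 0\<close>, and it does
  not depend on the sign of \<open>k\<close>.
\<close>

abbreviation int_quot :: "int \<Rightarrow> int set monoid"
  where "int_quot k \<equiv> add_monoid (ZFact k)"

definition group_power :: "('a, 'm) monoid_scheme \<Rightarrow> nat \<Rightarrow> (nat \<Rightarrow> 'a) monoid"
  where "group_power G k = product_group {..<k} (\<lambda>_. G)"

lemma comm_group_complex_units: "comm_group complex_units"
proof (rule comm_groupI)
  fix x assume "x \<in> carrier complex_units"
  then show "\<exists>y\<in>carrier complex_units. y \<otimes>\<^bsub>complex_units\<^esub> x = \<one>\<^bsub>complex_units\<^esub>"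
    by (intro bexI[of _ "inverse x"]) (auto simp: complex_units_def)
qed (auto simp: complex_units_def)

lemma group_heisenberg_group:
  assumes "cring R" and t: "t \<in> carrier R"
  shows "group (heisenberg_group R t n)"
proof -
  interpret cring R by fact
  let ?I = "{1..n}"
  have sum_mem: "(\<Oplus>\<^bsub>R\<^esub>i\<in>?I. b i \<otimes>\<^bsub>R\<^esub> c i) \<in> carrier R"
    if "b \<in> ?I \<rightarrow> carrier R" "c \<in> ?I \<rightarrow> carrier R" for b c
    using that by (intro finsum_closed) auto
  have sum_l: "(\<Oplus>\<^bsub>R\<^esub>i\<in>?I. (\<lambda>i\<in>?I. b i \<oplus>\<^bsub>R\<^esub> b' i) i \<otimes>\<^bsub>R\<^esub> c i)
      = (\<Oplus>\<^bsub>R\<^esub>i\<in>?I. b i \<otimes>\<^bsub>R\<^esub> c i) \<oplus>\<^bsub>R\<^esub> (\<Oplus>\<^bsub>R\<^esub>i\<in>?I. b' i \<otimes>\<^bsub>R\<^esub> c i)"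
    if "b \<in> ?I \<rightarrow> carrier R" "b' \<in> ?I \<rightarrow> carrier R" "c \<in> ?I \<rightarrow> carrier R" for b b' c
  proof -
    have "(\<Oplus>\<^bsub>R\<^esub>i\<in>?I. (\<lambda>i\<in>?I. b i \<oplus>\<^bsub>R\<^esub> b' i) i \<otimes>\<^bsub>R\<^esub> c i)
        = (\<Oplus>\<^bsub>R\<^esub>i\<in>?I. b i \<otimes>\<^bsub>R\<^esub> c i \<oplus>\<^bsub>R\<^esub> b' i \<otimes>\<^bsub>R\<^esub> c i)"
      using that by (intro finsum_cong') (auto simp: l_distr Pi_iff)
    then show ?thesis using that by (subst (asm) finsum_addf) auto
  qed
  have sum_r: "(\<Oplus>\<^bsub>R\<^esub>i\<in>?I. b i \<otimes>\<^bsub>R\<^esub> (\<lambda>i\<in>?I. c i \<oplus>\<^bsub>R\<^esub> c' i) i)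
      = (\<Oplus>\<^bsub>R\<^esub>i\<in>?I. b i \<otimes>\<^bsub>R\<^esub> c i) \<oplus>\<^bsub>R\<^esub> (\<Oplus>\<^bsub>R\<^esub>i\<in>?I. b i \<otimes>\<^bsub>R\<^esub> c' i)"
    if "b \<in> ?I \<rightarrow> carrier R" "c \<in> ?I \<rightarrow> carrier R" "c' \<in> ?I \<rightarrow> carrier R" for b c c'
  proof -
    have "(\<Oplus>\<^bsub>R\<^esub>i\<in>?I. b i \<otimes>\<^bsub>R\<^esub> (\<lambda>i\<in>?I. c i \<oplus>\<^bsub>R\<^esub> c' i) i)
        = (\<Oplus>\<^bsub>R\<^esub>i\<in>?I. b i \<otimes>\<^bsub>R\<^esub> c i \<oplus>\<^bsub>R\<^esub> b i \<otimes>\<^bsub>R\<^esub> c' i)"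
      using that by (intro finsum_cong') (auto simp: r_distr Pi_iff)
    then show ?thesis using that by (subst (asm) finsum_addf) auto
  qed
  show ?thesis
  proof (rule groupI)
    fix x y assume "x \<in> carrier (heisenberg_group R t n)" "y \<in> carrier (heisenberg_group R t n)"
    then show "x \<otimes>\<^bsub>heisenberg_group R t n\<^esub> y \<in> carrier (heisenberg_group R t n)"
      using t by (auto simp: heisenberg_group_def PiE_iff intro!: sum_mem)
  next
    show "\<one>\<^bsub>heisenberg_group R t n\<^esub> \<in> carrier (heisenberg_group R t n)"
      by (auto simp: heisenberg_group_def)
  next
    fix x y z
    assume "x \<in> carrier (heisenberg_group R t n)" "y \<in> carrier (heisenberg_group R t n)"
      "z \<in> carrier (heisenberg_group R t n)"
    then obtain a b c a' b' c' a'' b'' c'' where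
      xyz: "x = (a, b, c)" "y = (a', b', c')" "z = (a'', b'', c'')"
      and a: "a \<in> carrier R" "a' \<in> carrier R" "a'' \<in> carrier R"
      and b: "b \<in> ?I \<rightarrow> carrier R" "b' \<in> ?I \<rightarrow> carrier R" "b'' \<in> ?I \<rightarrow> carrier R"
      and c: "c \<in> ?I \<rightarrow> carrier R" "c' \<in> ?I \<rightarrow> carrier R" "c'' \<in> ?I \<rightarrow> carrier R"
      by (auto simp: heisenberg_group_def PiE_def)
    have bc: "\<And>i. i \<in> ?I \<Longrightarrow> b i \<in> carrier R \<and> b' i \<in> carrier R \<and> b'' i \<in> carrier R
        \<and> c i \<in> carrier R \<and> c' i \<in> carrier R \<and> c'' i \<in> carrier R"
      using b c by (auto simp: Pi_iff)
    show "x \<otimes>\<^bsub>heisenberg_group R t n\<^esub> y \<otimes>\<^bsub>heisenberg_group R t n\<^esub> z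
        = x \<otimes>\<^bsub>heisenberg_group R t n\<^esub> (y \<otimes>\<^bsub>heisenberg_group R t n\<^esub> z)"
      unfolding xyz heisenberg_group_def monoid.simps prod.case prod.inject
    proof (intro conjI)
      show "a \<oplus>\<^bsub>R\<^esub> a' \<oplus>\<^bsub>R\<^esub> t \<otimes>\<^bsub>R\<^esub> (\<Oplus>\<^bsub>R\<^esub>i\<in>?I. b' i \<otimes>\<^bsub>R\<^esub> c i) \<oplus>\<^bsub>R\<^esub> a''
          \<oplus>\<^bsub>R\<^esub> t \<otimes>\<^bsub>R\<^esub> (\<Oplus>\<^bsub>R\<^esub>i\<in>?I. b'' i \<otimes>\<^bsub>R\<^esub> (\<lambda>i\<in>?I. c i \<oplus>\<^bsub>R\<^esub> c' i) i)
        = a \<oplus>\<^bsub>R\<^esub> (a' \<oplus>\<^bsub>R\<^esub> a'' \<oplus>\<^bsub>R\<^esub> t \<otimes>\<^bsub>R\<^esub> (\<Oplus>\<^bsub>R\<^esub>i\<in>?I. b'' i \<otimes>\<^bsub>R\<^esub> c' i))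
          \<oplus>\<^bsub>R\<^esub> t \<otimes>\<^bsub>R\<^esub> (\<Oplus>\<^bsub>R\<^esub>i\<in>?I. (\<lambda>i\<in>?I. b' i \<oplus>\<^bsub>R\<^esub> b'' i) i \<otimes>\<^bsub>R\<^esub> c i)"
        unfolding sum_l[OF b(2,3) c(1)] sum_r[OF b(3) c(1,2)]
        using a t sum_mem[OF b(2) c(1)] sum_mem[OF b(3) c(1)] sum_mem[OF b(3) c(2)]
        by (simp add: r_distr a_ac)
    qed (auto simp: fun_eq_iff bc a_assoc)
  next
    fix x assume "x \<in> carrier (heisenberg_group R t n)"
    then obtain a b c where
      x: "x = (a, b, c)" and a: "a \<in> carrier R"
      and b: "b \<in> ?I \<rightarrow>\<^sub>E carrier R" and c: "c \<in> ?I \<rightarrow>\<^sub>E carrier R"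
      by (auto simp: heisenberg_group_def)
    have bc: "\<And>i. i \<in> ?I \<Longrightarrow> b i \<in> carrier R \<and> c i \<in> carrier R"
      using b c by (auto simp: PiE_iff)
    have zero: "(\<Oplus>\<^bsub>R\<^esub>i\<in>?I. b i \<otimes>\<^bsub>R\<^esub> (\<lambda>i\<in>?I. \<zero>\<^bsub>R\<^esub>) i) = \<zero>\<^bsub>R\<^esub>"
      by (rule add.finprod_one_eqI) (simp add: bc)
    show "\<one>\<^bsub>heisenberg_group R t n\<^esub> \<otimes>\<^bsub>heisenberg_group R t n\<^esub> x = x"
      unfolding x heisenberg_group_def monoid.simps prod.case zero
      using a t b c by (auto simp: fun_eq_iff PiE_iff extensional_def)
    let ?s = "\<Oplus>\<^bsub>R\<^esub>i\<in>?I. b i \<otimes>\<^bsub>R\<^esub> (\<lambda>i\<in>?I. \<ominus>\<^bsub>R\<^esub> c i) i"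
    have s: "?s \<in> carrier R"
      using bc by (intro sum_mem) auto
    let ?y = "(\<ominus>\<^bsub>R\<^esub> (a \<oplus>\<^bsub>R\<^esub> t \<otimes>\<^bsub>R\<^esub> ?s), \<lambda>i\<in>?I. \<ominus>\<^bsub>R\<^esub> b i, \<lambda>i\<in>?I. \<ominus>\<^bsub>R\<^esub> c i)"
    show "\<exists>y\<in>carrier (heisenberg_group R t n).
        y \<otimes>\<^bsub>heisenberg_group R t n\<^esub> x = \<one>\<^bsub>heisenberg_group R t n\<^esub>"
    proof (rule bexI[of _ ?y])
      have "\<ominus>\<^bsub>R\<^esub> (a \<oplus>\<^bsub>R\<^esub> t \<otimes>\<^bsub>R\<^esub> ?s) \<oplus>\<^bsub>R\<^esub> a \<oplus>\<^bsub>R\<^esub> t \<otimes>\<^bsub>R\<^esub> ?s = \<zero>\<^bsub>R\<^esub>"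
        using a t s by (simp add: a_assoc l_neg)
      then show "?y \<otimes>\<^bsub>heisenberg_group R t n\<^esub> x = \<one>\<^bsub>heisenberg_group R t n\<^esub>"
        unfolding x heisenberg_group_def monoid.simps prod.case
        by (auto simp: fun_eq_iff bc l_neg)
      show "?y \<in> carrier (heisenberg_group R t n)"
        using a t s bc by (auto simp: heisenberg_group_def)
    qed
  qed
qed

lemma comm_group_cochains2:
  assumes "comm_group A"
  shows "comm_group (cochains2 G A)"
proof -
  interpret A: comm_group A by fact
  have "group (cochains2 G A)"
    unfolding cochains2_def by (rule product_group) (rule A.group_axioms)
  then show ?thesis
    by (rule group.group_comm_groupI)
       (auto simp: cochains2_def PiE_iff A.m_comm intro!: restrict_ext)
qed

lemma subgroup_cocycles2:
  assumes "group G" "comm_group A"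
  shows "subgroup (cocycles2 G A) (cochains2 G A)"
proof -
  interpret G: group G by fact
  interpret A: comm_group A by fact
  interpret C: comm_group "cochains2 G A" using assms(2) by (rule comm_group_cochains2)
  have mem: "f (x, y) \<in> carrier A"
    if "f \<in> carrier (cochains2 G A)" "x \<in> carrier G" "y \<in> carrier G" for f x y
    using that by (auto simp: cochains2_def)
  have prod: "f \<otimes>\<^bsub>cochains2 G A\<^esub> g \<in> cocycles2 G A"
    if fg: "f \<in> cocycles2 G A" "g \<in> cocycles2 G A" for f g
  proof -
    have C: "f \<in> carrier (cochains2 G A)" "g \<in> carrier (cochains2 G A)"
      using fg by (auto simp: cocycles2_def)
    have "f (x, y) \<otimes>\<^bsub>A\<^esub> g (x, y) \<otimes>\<^bsub>A\<^esub> (f (x \<otimes>\<^bsub>G\<^esub> y, z) \<otimes>\<^bsub>A\<^esub> g (x \<otimes>\<^bsub>G\<^esub> y, z))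
        = f (y, z) \<otimes>\<^bsub>A\<^esub> g (y, z) \<otimes>\<^bsub>A\<^esub> (f (x, y \<otimes>\<^bsub>G\<^esub> z) \<otimes>\<^bsub>A\<^esub> g (x, y \<otimes>\<^bsub>G\<^esub> z))"
      if xyz: "x \<in> carrier G" "y \<in> carrier G" "z \<in> carrier G" for x y z
    proof -
      note m = mem[OF C(1)] mem[OF C(2)]
      have "f (x, y) \<otimes>\<^bsub>A\<^esub> g (x, y) \<otimes>\<^bsub>A\<^esub> (f (x \<otimes>\<^bsub>G\<^esub> y, z) \<otimes>\<^bsub>A\<^esub> g (x \<otimes>\<^bsub>G\<^esub> y, z))
          = (f (x, y) \<otimes>\<^bsub>A\<^esub> f (x \<otimes>\<^bsub>G\<^esub> y, z)) \<otimes>\<^bsub>A\<^esub> (g (x, y) \<otimes>\<^bsub>A\<^esub> g (x \<otimes>\<^bsub>G\<^esub> y, z))"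
        using xyz by (simp add: m A.m_ac)
      also have "\<dots> = (f (y, z) \<otimes>\<^bsub>A\<^esub> f (x, y \<otimes>\<^bsub>G\<^esub> z)) \<otimes>\<^bsub>A\<^esub> (g (y, z) \<otimes>\<^bsub>A\<^esub> g (x, y \<otimes>\<^bsub>G\<^esub> z))"
        using fg xyz by (simp add: cocycles2_def)
      also have "\<dots> = f (y, z) \<otimes>\<^bsub>A\<^esub> g (y, z) \<otimes>\<^bsub>A\<^esub> (f (x, y \<otimes>\<^bsub>G\<^esub> z) \<otimes>\<^bsub>A\<^esub> g (x, y \<otimes>\<^bsub>G\<^esub> z))"
        using xyz by (simp add: m A.m_ac)
      finally show ?thesis .
    qed
    with C.m_closed[OF C] show ?thesis
      by (auto simp: cocycles2_def cochains2_def)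
  qed
  have inver: "inv\<^bsub>cochains2 G A\<^esub> f \<in> cocycles2 G A" if f: "f \<in> cocycles2 G A" for f
  proof -
    have C: "f \<in> carrier (cochains2 G A)" using f by (auto simp: cocycles2_def)
    have eq: "inv\<^bsub>cochains2 G A\<^esub> f = (\<lambda>p\<in>carrier G \<times> carrier G. inv\<^bsub>A\<^esub> f p)"
      using C unfolding cochains2_def by (subst inv_product_group) auto
    have "inv\<^bsub>A\<^esub> f (x, y) \<otimes>\<^bsub>A\<^esub> inv\<^bsub>A\<^esub> f (x \<otimes>\<^bsub>G\<^esub> y, z)
        = inv\<^bsub>A\<^esub> f (y, z) \<otimes>\<^bsub>A\<^esub> inv\<^bsub>A\<^esub> f (x, y \<otimes>\<^bsub>G\<^esub> z)"
      if "x \<in> carrier G" "y \<in> carrier G" "z \<in> carrier G" for x y z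
      using that f by (simp add: mem[OF C] A.inv_mult[symmetric] cocycles2_def)
    with C.inv_closed[OF C] show ?thesis
      unfolding eq by (auto simp: cocycles2_def)
  qed
  have one: "\<one>\<^bsub>cochains2 G A\<^esub> \<in> cocycles2 G A"
    using C.one_closed by (auto simp: cocycles2_def cochains2_def)
  show ?thesis
    by (rule C.subgroupI) (use prod inver one in \<open>auto simp: cocycles2_def\<close>)
qed

lemma subgroup_coboundaries2:
  assumes "group G" "comm_group A"
  shows "subgroup (coboundaries2 G A) ((cochains2 G A)\<lparr>carrier := cocycles2 G A\<rparr>)"
proof -
  interpret G: group G by fact
  interpret A: comm_group A by fact
  interpret C: comm_group "cochains2 G A" using assms(2) by (rule comm_group_cochains2)
  have sub: "coboundaries2 G A \<subseteq> cocycles2 G A"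
  proof
    fix f assume "f \<in> coboundaries2 G A"
    then obtain \<phi> where f: "f = coboundary2 G A \<phi>" and phi: "\<phi> \<in> carrier G \<rightarrow> carrier A"
      by (auto simp: coboundaries2_def)
    have m: "\<phi> x \<in> carrier A" if "x \<in> carrier G" for x using phi that by auto
    have "f (x, y) \<otimes>\<^bsub>A\<^esub> f (x \<otimes>\<^bsub>G\<^esub> y, z) = f (y, z) \<otimes>\<^bsub>A\<^esub> f (x, y \<otimes>\<^bsub>G\<^esub> z)"
      if xyz: "x \<in> carrier G" "y \<in> carrier G" "z \<in> carrier G" for x y z
    proof -
      have canc: "u \<otimes>\<^bsub>A\<^esub> inv\<^bsub>A\<^esub> v \<otimes>\<^bsub>A\<^esub> (v \<otimes>\<^bsub>A\<^esub> w) = u \<otimes>\<^bsub>A\<^esub> w"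
        if "u \<in> carrier A" "v \<in> carrier A" "w \<in> carrier A" for u v w
        using that by (metis A.inv_closed A.m_assoc A.m_closed A.l_inv A.l_one)
      have "f (x, y) \<otimes>\<^bsub>A\<^esub> f (x \<otimes>\<^bsub>G\<^esub> y, z)
          = (\<phi> x \<otimes>\<^bsub>A\<^esub> \<phi> y) \<otimes>\<^bsub>A\<^esub> (\<phi> z \<otimes>\<^bsub>A\<^esub> inv\<^bsub>A\<^esub> \<phi> (x \<otimes>\<^bsub>G\<^esub> y \<otimes>\<^bsub>G\<^esub> z))"
        using xyz canc[of "\<phi> x \<otimes>\<^bsub>A\<^esub> \<phi> y" "\<phi> (x \<otimes>\<^bsub>G\<^esub> y)" "\<phi> z \<otimes>\<^bsub>A\<^esub> inv\<^bsub>A\<^esub> \<phi> (x \<otimes>\<^bsub>G\<^esub> y \<otimes>\<^bsub>G\<^esub> z)"]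
        by (simp add: f coboundary2_def m A.m_assoc)
      also have "\<dots> = f (y, z) \<otimes>\<^bsub>A\<^esub> f (x, y \<otimes>\<^bsub>G\<^esub> z)"
        using xyz canc[of "\<phi> y \<otimes>\<^bsub>A\<^esub> \<phi> z" "\<phi> (y \<otimes>\<^bsub>G\<^esub> z)" "\<phi> x \<otimes>\<^bsub>A\<^esub> inv\<^bsub>A\<^esub> \<phi> (x \<otimes>\<^bsub>G\<^esub> y \<otimes>\<^bsub>G\<^esub> z)"]
        by (simp add: f coboundary2_def m A.m_ac G.m_assoc)
      finally show ?thesis .
    qed
    moreover have "f \<in> carrier (cochains2 G A)"
      by (auto simp: f coboundary2_def cochains2_def m)
    ultimately show "f \<in> cocycles2 G A" by (auto simp: cocycles2_def)
  qed
  have "subgroup (coboundaries2 G A) (cochains2 G A)"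
  proof (rule C.subgroupI)
    show "coboundaries2 G A \<subseteq> carrier (cochains2 G A)"
      using sub by (auto simp: cocycles2_def)
    show "coboundaries2 G A \<noteq> {}"
      by (auto simp: coboundaries2_def intro!: exI[of _ "\<lambda>_. \<one>\<^bsub>A\<^esub>"])
  next
    fix f assume fB: "f \<in> coboundaries2 G A"
    then obtain \<phi> where f: "f = coboundary2 G A \<phi>" and phi: "\<phi> \<in> carrier G \<rightarrow> carrier A"
      by (auto simp: coboundaries2_def)
    have m: "\<phi> x \<in> carrier A" if "x \<in> carrier G" for x using phi that by auto
    have "f \<in> carrier (cochains2 G A)" using fB sub by (auto simp: cocycles2_def)
    then have "inv\<^bsub>cochains2 G A\<^esub> f = (\<lambda>p\<in>carrier G \<times> carrier G. inv\<^bsub>A\<^esub> f p)"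
      unfolding cochains2_def by (subst inv_product_group) auto
    also have "\<dots> = coboundary2 G A (\<lambda>x. inv\<^bsub>A\<^esub> \<phi> x)"
      by (auto simp: fun_eq_iff f coboundary2_def m A.inv_mult)
    finally show "inv\<^bsub>cochains2 G A\<^esub> f \<in> coboundaries2 G A"
      using m by (auto simp: coboundaries2_def)
  next
    fix f g assume "f \<in> coboundaries2 G A" "g \<in> coboundaries2 G A"
    then obtain \<phi> \<psi> where fg: "f = coboundary2 G A \<phi>" "g = coboundary2 G A \<psi>"
      and phi: "\<phi> \<in> carrier G \<rightarrow> carrier A" "\<psi> \<in> carrier G \<rightarrow> carrier A"
      by (auto simp: coboundaries2_def)
    have m: "\<phi> x \<in> carrier A" "\<psi> x \<in> carrier A" if "x \<in> carrier G" for x using phi that by auto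
    have "f \<otimes>\<^bsub>cochains2 G A\<^esub> g = coboundary2 G A (\<lambda>x. \<phi> x \<otimes>\<^bsub>A\<^esub> \<psi> x)"
      by (auto simp: fun_eq_iff fg coboundary2_def cochains2_def m A.inv_mult A.m_ac)
    then show "f \<otimes>\<^bsub>cochains2 G A\<^esub> g \<in> coboundaries2 G A"
      using m by (auto simp: coboundaries2_def)
  qed
  then show ?thesis
    using sub subgroup_cocycles2[OF assms] by (simp add: C.subgroup_incl)
qed

lemma comm_group_cohomology2:
  assumes "group G" "comm_group A"
  shows "comm_group (cohomology2 G A)"
proof -
  interpret C: comm_group "cochains2 G A" using assms(2) by (rule comm_group_cochains2)
  have "comm_group ((cochains2 G A)\<lparr>carrier := cocycles2 G A\<rparr>)"
    by (rule group.group_comm_groupI)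
       (use subgroup_cocycles2[OF assms] in
         \<open>auto intro: C.subgroup_imp_group C.m_comm dest: subgroup.mem_carrier\<close>)
  then show ?thesis
    unfolding cohomology2_def
    by (rule comm_group.abelian_FactGroup) (rule subgroup_coboundaries2[OF assms])
qed

end

theory Submission
  imports Defs
begin

text \<open>
  A 2-cocycle \<open>f\<close> with values in \<open>\<complex>\<^sup>\<times>\<close> is a central extension \<open>E\<close> of the Heisenberg group.  Lift the
  generators \<open>x\<^sub>1, \<dots>, x\<^sub>n, y\<^sub>1, \<dots>, y\<^sub>n\<close> and the central generator \<open>z\<close> to \<open>E\<close>.  Commutators of lifts
  do not depend on the lifts.  For commuting pairs of generators they are scalars, and
  \<open>C\<^sub>i = [y\<^sub>i, x\<^sub>i]\<close> lies over \<open>z\<^sup>t\<close>; so besides the scalars of the commuting pairs we obtain the scalars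
  \<open>C\<^sub>i C\<^sub>1\<^sup>-\<^sup>1\<close> for \<open>i \<ge> 2\<close> and, if \<open>r > 0\<close>, the scalar \<open>C\<^sub>1\<^sup>m\<close> with \<open>m = r / |t|\<close>, as \<open>z\<^sup>r = 1\<close>.

  As \<open>x\<^sub>i\<^sup>r = 1\<close> lifts to a scalar, commutators of lifts are killed by \<open>r\<close>, where for
  \<open>C\<^sub>i\<^sup>r = 1\<close> one needs that the scalar \<open>[x\<^sub>i, C\<^sub>i]\<close> is killed by \<open>r choose 2\<close>; this is where \<open>n > 1\<close> or
  the parity of \<open>r\<close> enters.  If \<open>n > 1\<close>, every generator other
  than \<open>z\<close> commutes modulo scalars with some pair \<open>x\<^sub>i, y\<^sub>i\<close>, hence with \<open>C\<^sub>i\<close>, hence with the \<open>t\<close>-th power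
  of a lift of \<open>z\<close>; so its commutator with \<open>z\<close> is killed by \<open>t\<close>.  If all the scalars are trivial,
  \<open>\<complex>\<^sup>\<times>\<close> being divisible one can choose lifts that satisfy the relations of the Heisenberg group,
  and \<open>E\<close> splits.  Conversely, all admissible values are attained by explicit cocycles, most of them
  bilinear.  Counting pairs of generators gives the result.
\<close>

subsection \<open>Commutation relations and ordered products\<close>

context group begin

text \<open>Conjugation by \<open>y\<close> is an endomorphism that sends \<open>x\<close> to
  \<open>c \<otimes> x\<close>, and powers of \<open>c \<otimes> x\<close> split because
  \<open>c\<close> commutes with \<open>x\<close>.\<close>

lemma commutator_int_pow_right:
  assumes [simp]: "x \<in> carrier G" "y \<in> carrier G" "c \<in> carrier G"
    and yx: "y \<otimes> x = c \<otimes> (x \<otimes> y)" and cx: "c \<otimes> x = x \<otimes> c"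
  shows "y \<otimes> x [^] (k::int) = c [^] k \<otimes> (x [^] k \<otimes> y)"
proof -
  have hom: "(\<lambda>g. y \<otimes> g \<otimes> inv y) \<in> hom G G"
    by (auto simp: hom_def m_assoc inv_solve_left)
  have "y \<otimes> x \<otimes> inv y = c \<otimes> x"
    by (simp add: yx m_assoc)
  then have "y \<otimes> x [^] k \<otimes> inv y = (c \<otimes> x) [^] k"
    using hom_int_pow[OF hom _ group_axioms group_axioms, of x k] by simp
  also have "\<dots> = c [^] k \<otimes> x [^] k"
    by (simp add: int_pow_mult_distrib[OF cx])
  finally have "y \<otimes> x [^] k \<otimes> inv y \<otimes> y = c [^] k \<otimes> x [^] k \<otimes> y"
    by simp
  then show ?thesis by (simp add: m_assoc)
qed

text \<open>The relation is read backwards, with \<open>x\<close> and \<open>y\<close> exchanged and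
  \<open>inv c\<close> in the role of \<open>c\<close>, which reduces it to the previous
  case.\<close>

lemma commutator_int_pow_left:
  assumes [simp]: "x \<in> carrier G" "y \<in> carrier G" "c \<in> carrier G"
    and yx: "y \<otimes> x = c \<otimes> (x \<otimes> y)" and cy: "c \<otimes> y = y \<otimes> c"
  shows "y [^] (k::int) \<otimes> x = c [^] k \<otimes> (x \<otimes> y [^] k)"
proof -
  have "inv c \<otimes> (y \<otimes> x) = inv c \<otimes> (c \<otimes> (x \<otimes> y))" using yx by simp
  then have xy: "x \<otimes> y = inv c \<otimes> (y \<otimes> x)" by (simp add: m_assoc[symmetric])
  have "inv c \<otimes> y = y \<otimes> inv c"
    by (metis assms(2,3) cy inv_closed inv_solve_right' m_assoc inv_solve_left m_closed)
  from commutator_int_pow_right[OF _ _ _ xy this, of k]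
  have "x \<otimes> y [^] k = inv (c [^] k) \<otimes> (y [^] k \<otimes> x)" by (simp add: int_pow_inv)
  then have "c [^] k \<otimes> (x \<otimes> y [^] k) = c [^] k \<otimes> (inv (c [^] k) \<otimes> (y [^] k \<otimes> x))" by simp
  then show ?thesis by (simp add: m_assoc[symmetric])
qed

lemma commute_int_pow:
  assumes [simp]: "x \<in> carrier G" "y \<in> carrier G" and "y \<otimes> x = x \<otimes> y"
  shows "y \<otimes> x [^] (k::int) = x [^] k \<otimes> y"
  using commutator_int_pow_right[of x y "\<one>" k] assms(3) by simp

lemma commutator_int_pow:
  assumes [simp]: "x \<in> carrier G" "y \<in> carrier G" "c \<in> carrier G"
    and yx: "y \<otimes> x = c \<otimes> (x \<otimes> y)" and cx: "c \<otimes> x = x \<otimes> c" and cy: "c \<otimes> y = y \<otimes> c"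
  shows "y [^] (m::int) \<otimes> x [^] (k::int) = c [^] (m * k) \<otimes> (x [^] k \<otimes> y [^] m)"
proof -
  have "y [^] m \<otimes> x = c [^] m \<otimes> (x \<otimes> y [^] m)"
    by (rule commutator_int_pow_left) (use assms in auto)
  moreover have "c [^] m \<otimes> x = x \<otimes> c [^] m"
    using commute_int_pow[of c x m] cx by simp
  ultimately show ?thesis
    using commutator_int_pow_right[of x "y [^] m" "c [^] m" k] by (simp add: int_pow_pow)
qed

text \<open>Collecting every \<open>c\<close> on the left moves the j-th one across j - 1 factors
  \<open>x\<close>. Each crossing costs one \<open>w\<close>, which commutes with everything
  involved, and there are \<open>k choose 2\<close> crossings.\<close>

lemma mult_nat_pow_commutator:
  assumes [simp]: "x \<in> carrier G" "c \<in> carrier G" "w \<in> carrier G"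
    and xc: "x \<otimes> c = w \<otimes> (c \<otimes> x)" and w: "w \<otimes> x = x \<otimes> w" "w \<otimes> c = c \<otimes> w"
  shows "(c \<otimes> x) [^] (k::nat) = w [^] (k choose 2) \<otimes> (c [^] k \<otimes> x [^] k)"
proof (induction k)
  case 0
  then show ?case by (simp add: numeral_2_eq_2)
next
  case (Suc k)
  have wk: "x [^] k \<otimes> c = w [^] k \<otimes> (c \<otimes> x [^] k)"
    using commutator_int_pow_left[of c x w "int k"] xc w by (simp add: int_pow_int)
  have wc: "c [^] k \<otimes> w [^] k = w [^] k \<otimes> c [^] k"
  proof -
    have "c [^] k \<otimes> w = w \<otimes> c [^] k"
      using commute_int_pow[of c w "int k"] w(2) by (simp add: int_pow_int)
    then show ?thesis
      using commute_int_pow[of w "c [^] k" "int k"] by (simp add: int_pow_int)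
  qed
  have "(c \<otimes> x) [^] Suc k = w [^] (k choose 2) \<otimes> (c [^] k \<otimes> (x [^] k \<otimes> c) \<otimes> x)"
    by (simp add: Suc m_assoc)
  also have "\<dots> = w [^] (k choose 2) \<otimes> ((c [^] k \<otimes> w [^] k) \<otimes> (c \<otimes> (x [^] k \<otimes> x)))"
    by (simp add: wk m_assoc)
  also have "\<dots> = (w [^] (k choose 2) \<otimes> w [^] k) \<otimes> ((c [^] k \<otimes> c) \<otimes> (x [^] k \<otimes> x))"
    by (simp add: wc m_assoc)
  also have "\<dots> = w [^] (Suc k choose 2) \<otimes> (c [^] Suc k \<otimes> x [^] Suc k)"
    by (simp add: nat_pow_mult numeral_2_eq_2 add.commute)
  finally show ?case .
qed

end

text \<open>
  The element \<open>(a, b, c)\<close> of the Heisenberg group over \<open>\<int>\<close> is the family \<open>v\<close> with \<open>v 0 = a\<close>,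
  \<open>v i = b i\<close> and \<open>v (n + i) = c i\<close> for \<open>1 \<le> i \<le> n\<close>; values beyond \<open>2 * n\<close> are irrelevant.
\<close>

definition heis_mult :: "int \<Rightarrow> nat \<Rightarrow> (nat \<Rightarrow> int) \<Rightarrow> (nat \<Rightarrow> int) \<Rightarrow> nat \<Rightarrow> int"
  where "heis_mult t n v w = (\<lambda>k. v k + w k + (if k = 0 then t * (\<Sum>i=1..n. w i * v (n + i)) else 0))"

section \<open>Ordered products of generators subject to the Heisenberg relations\<close>

primrec ordered_prod :: "('a, 'b) monoid_scheme \<Rightarrow> (nat \<Rightarrow> 'a) \<Rightarrow> nat \<Rightarrow> (nat \<Rightarrow> int) \<Rightarrow> 'a" where
  "ordered_prod G W 0 v = W 0 [^]\<^bsub>G\<^esub> v 0"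
| "ordered_prod G W (Suc k) v = ordered_prod G W k v \<otimes>\<^bsub>G\<^esub> W (Suc k) [^]\<^bsub>G\<^esub> v (Suc k)"

text \<open>Intended for lifts of the generators to a central extension: as soon as these obey the
  commutation relations, \<open>ordered_prod_hom\<close> makes their ordered products multiplicative
  in integral coordinates.\<close>

locale heis_relations = group +
  fixes W :: "nat \<Rightarrow> 'a" and t :: int and n :: nat
  assumes W_closed: "p \<le> 2 * n \<Longrightarrow> W p \<in> carrier G"
    and W_rel: "p < q \<Longrightarrow> q \<le> 2 * n \<Longrightarrow>
      W q \<otimes> W p = (if p > 0 \<and> q = n + p then W 0 [^] t else \<one>) \<otimes> (W p \<otimes> W q)"
begin

abbreviation "S \<equiv> ordered_prod G W"

lemma S_closed [simp]: "k \<le> 2 * n \<Longrightarrow> S k v \<in> carrier G"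
  by (induction k) (auto simp: W_closed)

lemma W0_closed [simp]: "W 0 \<in> carrier G"
  by (simp add: W_closed)

lemma W0_commute:
  assumes "q \<le> 2 * n" shows "W 0 [^] (a::int) \<otimes> W q [^] (b::int) = W q [^] b \<otimes> W 0 [^] a"
proof -
  have "W q \<otimes> W 0 = \<one> \<otimes> (W 0 \<otimes> W q)"
    using W_rel[of 0 q] assms by (cases "q = 0") (auto simp: W_closed)
  then show ?thesis
    using commutator_int_pow[of "W 0" "W q" \<one> b a] assms by (simp add: W_closed)
qed

lemma W0_S_commute: "k \<le> 2 * n \<Longrightarrow> W 0 [^] (a::int) \<otimes> S k v = S k v \<otimes> W 0 [^] a"
proof (induction k)
  case 0
  then show ?case using W0_commute[of 0] by simp
next
  case (Suc k)
  have "W 0 [^] a \<otimes> S (Suc k) v = (W 0 [^] a \<otimes> S k v) \<otimes> W (Suc k) [^] v (Suc k)"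
    using Suc.prems by (simp add: m_assoc W_closed)
  also have "\<dots> = S k v \<otimes> (W 0 [^] a \<otimes> W (Suc k) [^] v (Suc k))"
    using Suc by (simp add: m_assoc W_closed)
  also have "\<dots> = S (Suc k) v \<otimes> W 0 [^] a"
    using Suc.prems by (simp add: W0_commute m_assoc W_closed)
  finally show ?case .
qed

lemma W0_S: "k \<le> 2 * n \<Longrightarrow> W 0 [^] (a::int) \<otimes> S k v = S k (v(0 := v 0 + a))"
proof (induction k)
  case 0
  then show ?case by (simp add: int_pow_mult[symmetric] add.commute)
next
  case (Suc k)
  then show ?case by (simp add: m_assoc[symmetric] W_closed)
qed

text \<open>Among \<open>W 0\<close>, ..., \<open>W j\<close> only the partner
  \<open>W (q - n)\<close> can fail to commute with \<open>W q\<close>, so at most one correction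
  arises, a power of the central \<open>W 0\<close>.\<close>

lemma W_S_commute:
  assumes q: "q \<le> 2 * n"
  shows "j < q \<Longrightarrow> W q [^] (m::int) \<otimes> S j w
    = W 0 [^] (t * (if n < q \<and> q - n \<le> j then w (q - n) * m else 0)) \<otimes> (S j w \<otimes> W q [^] m)"
proof (induction j)
  case 0
  then show ?case using q by (auto simp: W0_commute W_closed)
next
  case (Suc j)
  let ?z = "\<lambda>j. W 0 [^] (t * (if n < q \<and> q - n \<le> j then w (q - n) * m else 0))"
  let ?d = "W 0 [^] (t * (if q = n + Suc j then w (Suc j) * m else 0))"
  let ?x = "W (Suc j) [^] w (Suc j)"
  have cl [simp]: "W (Suc j) \<in> carrier G" "W q \<in> carrier G" "S j w \<in> carrier G"
    using Suc.prems q by (auto simp: W_closed)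
  have rel: "W q [^] m \<otimes> ?x = ?d \<otimes> (?x \<otimes> W q [^] m)"
  proof (cases "q = n + Suc j")
    case True
    have "W 0 [^] t \<otimes> W p = W p \<otimes> W 0 [^] t" if "p \<le> 2 * n" for p
      using W0_commute[OF that, of t 1] that by (simp add: W_closed)
    then have "W q [^] m \<otimes> ?x = (W 0 [^] t) [^] (m * w (Suc j)) \<otimes> (?x \<otimes> W q [^] m)"
      using W_rel[of "Suc j" q] Suc.prems q True
      by (intro commutator_int_pow) (auto simp: W_closed)
    then show ?thesis using True by (simp add: int_pow_pow mult.commute)
  next
    case False
    have "W q [^] m \<otimes> ?x = \<one> [^] (m * w (Suc j)) \<otimes> (?x \<otimes> W q [^] m)"
      using W_rel[of "Suc j" q] Suc.prems q False by (intro commutator_int_pow) auto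
    then show ?thesis using False by simp
  qed
  have d: "S j w \<otimes> ?d = ?d \<otimes> S j w"
    using W0_S_commute[of j] Suc.prems q by simp
  have "W q [^] m \<otimes> S (Suc j) w = (W q [^] m \<otimes> S j w) \<otimes> ?x"
    by (simp add: m_assoc)
  also have "\<dots> = ?z j \<otimes> (S j w \<otimes> (W q [^] m \<otimes> ?x))"
    using Suc by (simp add: m_assoc)
  also have "\<dots> = ?z j \<otimes> ((S j w \<otimes> ?d) \<otimes> (?x \<otimes> W q [^] m))"
    unfolding rel by (simp add: m_assoc)
  also have "\<dots> = (?z j \<otimes> ?d) \<otimes> (S (Suc j) w \<otimes> W q [^] m)"
    unfolding d by (simp add: m_assoc)
  also have "?z j \<otimes> ?d = ?z (Suc j)"
  proof -
    have "q = n + Suc j \<longleftrightarrow> n < q \<and> q - n = Suc j" by linarith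
    then have "(if n < q \<and> q - n \<le> j then w (q - n) * m else 0) + (if q = n + Suc j then w (Suc j) * m else 0)
        = (if n < q \<and> q - n \<le> Suc j then w (q - n) * m else 0)"
      by (auto simp: le_Suc_eq)
    then show ?thesis
      by (subst int_pow_mult[symmetric]) (simp_all flip: distrib_left)
  qed
  finally show ?case .
qed

text \<open>The index set keeps only the dual pairs whose second member is among the first
  \<open>k\<close> generators. Hence the step to \<open>Suc k\<close> adds at most one term, the one
  from moving \<open>W (Suc k)\<close> across its partner in the right factor.\<close>

lemma S_mult:
  "k \<le> 2 * n \<Longrightarrow> S k v \<otimes> S k w
    = W 0 [^] (t * (\<Sum>i | 1 \<le> i \<and> i \<le> n \<and> n + i \<le> k. w i * v (n + i))) \<otimes> S k (\<lambda>i. v i + w i)"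
proof (induction k)
  case 0
  have "(\<Sum>i | 1 \<le> i \<and> i \<le> n \<and> n + i \<le> 0. w i * v (n + i)) = 0"
    by (rule sum.neutral) auto
  then show ?case by (simp only: mult_zero_right int_pow_0) (simp add: int_pow_mult)
next
  case (Suc k)
  let ?I = "\<lambda>k. {i. 1 \<le> i \<and> i \<le> n \<and> n + i \<le> k}"
  let ?q = "Suc k"
  let ?d = "W 0 [^] (t * (if n < ?q then w (?q - n) * v ?q else 0))"
  have cl [simp]: "W ?q \<in> carrier G" "\<And>v. S k v \<in> carrier G"
    using Suc.prems by (auto simp: W_closed)
  \<comment> \<open>The bound \<open>?q - n \<le> k\<close> in \<open>W_S_commute\<close>
    disappears, since \<open>Suc k \<le> 2 * n\<close> forces \<open>n > 0\<close>.\<close>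
  have *: "W ?q [^] v ?q \<otimes> S k w = ?d \<otimes> (S k w \<otimes> W ?q [^] v ?q)"
    using W_S_commute[of ?q k "v ?q" w] Suc.prems by (cases "n = 0") (auto split: if_splits)
  have "S ?q v \<otimes> S ?q w = S k v \<otimes> ((W ?q [^] v ?q \<otimes> S k w) \<otimes> W ?q [^] w ?q)"
    by (simp add: m_assoc)
  also have "\<dots> = (S k v \<otimes> ?d) \<otimes> (S k w \<otimes> (W ?q [^] v ?q \<otimes> W ?q [^] w ?q))"
    unfolding * by (simp add: m_assoc)
  also have "\<dots> = ?d \<otimes> ((S k v \<otimes> S k w) \<otimes> W ?q [^] (v ?q + w ?q))"
    using Suc.prems by (subst W0_S_commute[symmetric]) (auto simp: m_assoc int_pow_mult)
  also have "\<dots> = (?d \<otimes> W 0 [^] (t * (\<Sum>i\<in>?I k. w i * v (n + i)))) \<otimes> S ?q (\<lambda>i. v i + w i)"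
    using Suc by (simp add: m_assoc)
  also have "?d \<otimes> W 0 [^] (t * (\<Sum>i\<in>?I k. w i * v (n + i))) = W 0 [^] (t * (\<Sum>i\<in>?I ?q. w i * v (n + i)))"
  proof (cases "n < ?q")
    case True
    then have "?I ?q = insert (?q - n) (?I k)"
      using Suc.prems by auto
    moreover have "finite (?I k)" "?q - n \<notin> ?I k" using True by auto
    ultimately have "(\<Sum>i\<in>?I ?q. w i * v (n + i)) = w (?q - n) * v ?q + (\<Sum>i\<in>?I k. w i * v (n + i))"
      using True by simp
    then show ?thesis using True by (simp add: int_pow_mult[symmetric] distrib_left)
  next
    case False
    then have "?I ?q = {}" "?I k = {}" by auto
    then show ?thesis using False by (simp only: sum.empty) simp
  qed
  finally show ?case .
qed

lemma ordered_prod_hom: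
  "S (2 * n) (heis_mult t n v w) = S (2 * n) v \<otimes> S (2 * n) w"
proof -
  have I: "{i. 1 \<le> i \<and> i \<le> n \<and> n + i \<le> 2 * n} = {1..n}" by auto
  have "heis_mult t n v w = (\<lambda>i. v i + w i)(0 := v 0 + w 0 + t * (\<Sum>i=1..n. w i * v (n + i)))"
    by (auto simp: heis_mult_def)
  then show ?thesis
    by (simp add: S_mult[OF order_refl, unfolded I] W0_S)
qed

end

subsection \<open>Central extensions\<close>

text \<open>The cocycle may be unnormalised, whence the first component of the unit.\<close>

definition central_extension :: "('g, 'm) monoid_scheme \<Rightarrow> ('g \<times> 'g \<Rightarrow> complex) \<Rightarrow> (complex \<times> 'g) monoid"
  where "central_extension G f =
    \<lparr>carrier = (- {0}) \<times> carrier G,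
     monoid.mult = (\<lambda>(u, g) (v, h). (u * v * f (g, h), g \<otimes>\<^bsub>G\<^esub> h)),
     one = (1 / f (\<one>\<^bsub>G\<^esub>, \<one>\<^bsub>G\<^esub>), \<one>\<^bsub>G\<^esub>)\<rparr>"

lemma complex_units_simps [simp]:
  "carrier complex_units = - {0}" "x \<otimes>\<^bsub>complex_units\<^esub> y = x * y" "\<one>\<^bsub>complex_units\<^esub> = 1"
  by (simp_all add: complex_units_def)

lemma inv_complex_units: "x \<noteq> 0 \<Longrightarrow> inv\<^bsub>complex_units\<^esub> x = inverse x"
  using comm_group.axioms(1)[OF comm_group_complex_units]
  by (intro comm_monoid.comm_inv_char) auto

locale cocycle = group +
  fixes f :: "'a \<times> 'a \<Rightarrow> complex"
  assumes f: "f \<in> cocycles2 G complex_units"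
begin

lemma f_nonzero [simp]: "g \<in> carrier G \<Longrightarrow> h \<in> carrier G \<Longrightarrow> f (g, h) \<noteq> 0"
  using f by (auto simp: cocycles2_def cochains2_def PiE_iff)

lemma f_cocycle:
  "g \<in> carrier G \<Longrightarrow> h \<in> carrier G \<Longrightarrow> k \<in> carrier G \<Longrightarrow>
    f (g, h) * f (g \<otimes> h, k) = f (h, k) * f (g, h \<otimes> k)"
  using f by (auto simp: cocycles2_def)

definition f1 :: complex where "f1 = f (\<one>, \<one>)"

lemma f_one_left [simp]: "g \<in> carrier G \<Longrightarrow> f (\<one>, g) = f1"
  unfolding f1_def using f_cocycle[of \<one> \<one> g] by simp

lemma f_one_right [simp]: "g \<in> carrier G \<Longrightarrow> f (g, \<one>) = f1"
  unfolding f1_def using f_cocycle[of g \<one> \<one>] by simp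

lemma f1_nonzero [simp]: "f1 \<noteq> 0"
  using f_nonzero[of \<one> \<one>] unfolding f1_def by blast

abbreviation "E \<equiv> central_extension G f"

lemma E_simps:
  "carrier E = (- {0}) \<times> carrier G"
  "(u, g) \<otimes>\<^bsub>E\<^esub> (v, h) = (u * v * f (g, h), g \<otimes> h)"
  "\<one>\<^bsub>E\<^esub> = (1 / f1, \<one>)"
  by (simp_all add: central_extension_def)

lemma group_E: "group E"
proof (rule groupI)
  fix x y z assume "x \<in> carrier E" "y \<in> carrier E" "z \<in> carrier E"
  then obtain u g v h w k where *: "x = (u, g)" "y = (v, h)" "z = (w, k)"
    "g \<in> carrier G" "h \<in> carrier G" "k \<in> carrier G"
    by (metis E_simps(1) mem_Sigma_iff surj_pair)
  then show "x \<otimes>\<^bsub>E\<^esub> y \<otimes>\<^bsub>E\<^esub> z = x \<otimes>\<^bsub>E\<^esub> (y \<otimes>\<^bsub>E\<^esub> z)"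
    using f_cocycle[of g h k] by (simp add: E_simps m_assoc algebra_simps)
next
  fix x assume "x \<in> carrier E"
  then obtain u g where x: "x = (u, g)" "u \<noteq> 0" "g \<in> carrier G" by (auto simp: E_simps)
  then show "\<one>\<^bsub>E\<^esub> \<otimes>\<^bsub>E\<^esub> x = x" by (simp add: E_simps)
  have "(1 / (u * f (inv g, g) * f1), inv g) \<otimes>\<^bsub>E\<^esub> x = \<one>\<^bsub>E\<^esub>"
    using x by (simp add: E_simps)
  moreover have "(1 / (u * f (inv g, g) * f1), inv g) \<in> carrier E"
    using x by (simp add: E_simps)
  ultimately show "\<exists>y\<in>carrier E. y \<otimes>\<^bsub>E\<^esub> x = \<one>\<^bsub>E\<^esub>" by blast
qed (auto simp: E_simps)

sublocale E: group E by (rule group_E)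

text \<open>The embedding of the nonzero complex numbers as the central kernel of
  \<open>snd\<close>. Dividing by \<open>f1\<close> compensates the factor
  \<open>f (\<one>, \<one>)\<close> that the multiplication introduces.\<close>

definition scal :: "complex \<Rightarrow> complex \<times> 'a" where "scal u = (u / f1, \<one>)"

lemma scal_closed [simp]: "u \<noteq> 0 \<Longrightarrow> scal u \<in> carrier E"
  by (simp add: scal_def E_simps)

lemma scal_mult: "scal u \<otimes>\<^bsub>E\<^esub> scal v = scal (u * v)"
  by (simp add: scal_def E_simps)

lemma scal_one [simp]: "scal 1 = \<one>\<^bsub>E\<^esub>"
  by (simp add: scal_def E_simps)

lemma scal_eq_iff [simp]: "scal u = scal v \<longleftrightarrow> u = v"
  by (simp add: scal_def E_simps)

lemma scal_eq_one_iff: "scal u = \<one>\<^bsub>E\<^esub> \<longleftrightarrow> u = 1"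
  by (metis scal_eq_iff scal_one)

lemma scal_apply: "g \<in> carrier G \<Longrightarrow> scal u \<otimes>\<^bsub>E\<^esub> (v, g) = (u * v, g)"
  by (simp add: scal_def E_simps)

lemma scal_commute: "x \<in> carrier E \<Longrightarrow> x \<otimes>\<^bsub>E\<^esub> scal u = scal u \<otimes>\<^bsub>E\<^esub> x"
  by (auto simp: scal_def E_simps)

lemma scal_left_commute:
  "x \<in> carrier E \<Longrightarrow> y \<in> carrier E \<Longrightarrow> u \<noteq> 0 \<Longrightarrow> x \<otimes>\<^bsub>E\<^esub> (scal u \<otimes>\<^bsub>E\<^esub> y) = scal u \<otimes>\<^bsub>E\<^esub> (x \<otimes>\<^bsub>E\<^esub> y)"
  by (metis E.m_assoc scal_closed scal_commute)

lemma scal_nat_pow: "u \<noteq> 0 \<Longrightarrow> scal u [^]\<^bsub>E\<^esub> (k::nat) = scal (u ^ k)"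
  by (induction k) (auto simp: scal_mult mult.commute)

lemma inv_scal: "u \<noteq> 0 \<Longrightarrow> inv\<^bsub>E\<^esub> scal u = scal (inverse u)"
  by (rule E.inv_equality) (auto simp: scal_mult)

lemma scal_int_pow: "u \<noteq> 0 \<Longrightarrow> scal u [^]\<^bsub>E\<^esub> (k::int) = scal (u powi k)"
  by (cases k rule: int_cases2)
    (simp_all add: int_pow_int E.int_pow_neg_int scal_nat_pow inv_scal power_int_minus)

lemma snd_hom: "snd \<in> hom E G"
  by (auto simp: hom_def E_simps)

lemma snd_nat_pow: "x \<in> carrier E \<Longrightarrow> snd (x [^]\<^bsub>E\<^esub> (k::nat)) = snd x [^] k"
  by (induction k) (auto simp: central_extension_def split: prod.split)

lemma snd_int_pow: "x \<in> carrier E \<Longrightarrow> snd (x [^]\<^bsub>E\<^esub> (k::int)) = snd x [^] k"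
  using hom_int_pow[OF snd_hom _ group_E group_axioms] by blast

lemma same_snd:
  assumes "x \<in> carrier E" "y \<in> carrier E" "snd x = snd y"
  obtains u where "u \<noteq> 0" "x = scal u \<otimes>\<^bsub>E\<^esub> y"
proof -
  obtain a b g where "x = (a, g)" "y = (b, g)" "a \<noteq> 0" "b \<noteq> 0" "g \<in> carrier G"
    using assms by (metis ComplD E_simps(1) insertCI mem_Sigma_iff prod.collapse)
  then show ?thesis
    by (intro that[of "a / b"]) (auto simp: scal_apply)
qed

lemma snd_one:
  assumes "x \<in> carrier E" "snd x = \<one>"
  obtains u where "u \<noteq> 0" "x = scal u"
  using assms by (intro that[of "fst x * f1"]) (auto simp: scal_def E_simps)

lemma commute_up_to_scal:
  assumes "x \<in> carrier E" "y \<in> carrier E" "snd x \<otimes> snd y = snd y \<otimes> snd x"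
  obtains u where "u \<noteq> 0" "x \<otimes>\<^bsub>E\<^esub> y = scal u \<otimes>\<^bsub>E\<^esub> (y \<otimes>\<^bsub>E\<^esub> x)"
proof -
  have "snd (x \<otimes>\<^bsub>E\<^esub> y) = snd (y \<otimes>\<^bsub>E\<^esub> x)"
    using assms by (auto simp: E_simps)
  then show ?thesis
    using same_snd[of "x \<otimes>\<^bsub>E\<^esub> y" "y \<otimes>\<^bsub>E\<^esub> x"] that assms(1,2) E.m_closed by blast
qed

lemma scal_commutator_int_pow:
  assumes "x \<in> carrier E" "y \<in> carrier E" "u \<noteq> 0"
    and "y \<otimes>\<^bsub>E\<^esub> x = scal u \<otimes>\<^bsub>E\<^esub> (x \<otimes>\<^bsub>E\<^esub> y)"
  shows "y \<otimes>\<^bsub>E\<^esub> x [^]\<^bsub>E\<^esub> (k::int) = scal (u powi k) \<otimes>\<^bsub>E\<^esub> (x [^]\<^bsub>E\<^esub> k \<otimes>\<^bsub>E\<^esub> y)"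
  using E.commutator_int_pow_right[of x y "scal u" k] assms
  by (simp add: scal_commute scal_int_pow)

lemma scal_cancel:
  assumes "x \<in> carrier E" "u \<noteq> 0" "scal u \<otimes>\<^bsub>E\<^esub> x = x"
  shows "u = 1"
  using assms by (metis E.r_cancel_one scal_closed scal_eq_one_iff)

text \<open>Conjugation by \<open>w\<close> multiplies \<open>x\<close> and \<open>y\<close> by scalars, which cancel in their commutator \<open>c\<close>.\<close>

lemma commute_commutator:
  assumes [simp]: "x \<in> carrier E" "y \<in> carrier E" "c \<in> carrier E" "w \<in> carrier E"
    and yx: "y \<otimes>\<^bsub>E\<^esub> x = c \<otimes>\<^bsub>E\<^esub> (x \<otimes>\<^bsub>E\<^esub> y)"
    and wx: "snd w \<otimes> snd x = snd x \<otimes> snd w" and wy: "snd w \<otimes> snd y = snd y \<otimes> snd w"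
  shows "w \<otimes>\<^bsub>E\<^esub> c = c \<otimes>\<^bsub>E\<^esub> w"
proof -
  obtain a where a [simp]: "a \<noteq> 0" and ax: "w \<otimes>\<^bsub>E\<^esub> x = scal a \<otimes>\<^bsub>E\<^esub> (x \<otimes>\<^bsub>E\<^esub> w)"
    using commute_up_to_scal[OF assms(4,1) wx] by metis
  obtain b where b [simp]: "b \<noteq> 0" and bw: "w \<otimes>\<^bsub>E\<^esub> y = scal b \<otimes>\<^bsub>E\<^esub> (y \<otimes>\<^bsub>E\<^esub> w)"
    using commute_up_to_scal[OF assms(4,2) wy] by metis
  have wxz: "w \<otimes>\<^bsub>E\<^esub> (x \<otimes>\<^bsub>E\<^esub> z) = scal a \<otimes>\<^bsub>E\<^esub> (x \<otimes>\<^bsub>E\<^esub> (w \<otimes>\<^bsub>E\<^esub> z))" if "z \<in> carrier E" for z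
    using that ax by (metis E.m_assoc E.m_closed assms(1,4) a scal_closed)
  have wyz: "w \<otimes>\<^bsub>E\<^esub> (y \<otimes>\<^bsub>E\<^esub> z) = scal b \<otimes>\<^bsub>E\<^esub> (y \<otimes>\<^bsub>E\<^esub> (w \<otimes>\<^bsub>E\<^esub> z))" if "z \<in> carrier E" for z
    using that bw by (metis E.m_assoc E.m_closed assms(2,4) b scal_closed)
  have "w \<otimes>\<^bsub>E\<^esub> (c \<otimes>\<^bsub>E\<^esub> (x \<otimes>\<^bsub>E\<^esub> y)) = scal b \<otimes>\<^bsub>E\<^esub> (scal a \<otimes>\<^bsub>E\<^esub> ((y \<otimes>\<^bsub>E\<^esub> x) \<otimes>\<^bsub>E\<^esub> w))"
    unfolding yx[symmetric]
    by (simp add: wyz ax scal_left_commute[of y _ a] E.m_assoc)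
  also have "\<dots> = c \<otimes>\<^bsub>E\<^esub> (scal b \<otimes>\<^bsub>E\<^esub> (scal a \<otimes>\<^bsub>E\<^esub> (x \<otimes>\<^bsub>E\<^esub> y \<otimes>\<^bsub>E\<^esub> w)))"
    unfolding yx by (simp add: scal_left_commute[of c _ a] scal_left_commute[of c _ b] E.m_assoc)
  also have "scal b \<otimes>\<^bsub>E\<^esub> (scal a \<otimes>\<^bsub>E\<^esub> (x \<otimes>\<^bsub>E\<^esub> y \<otimes>\<^bsub>E\<^esub> w)) = w \<otimes>\<^bsub>E\<^esub> (x \<otimes>\<^bsub>E\<^esub> y)"
  proof -
    have "scal b \<otimes>\<^bsub>E\<^esub> (scal a \<otimes>\<^bsub>E\<^esub> (x \<otimes>\<^bsub>E\<^esub> y \<otimes>\<^bsub>E\<^esub> w)) = scal a \<otimes>\<^bsub>E\<^esub> (x \<otimes>\<^bsub>E\<^esub> (scal b \<otimes>\<^bsub>E\<^esub> (y \<otimes>\<^bsub>E\<^esub> w)))"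
      by (simp add: E.m_assoc scal_left_commute[of x _ b] scal_left_commute[of "scal a" _ b])
    then show ?thesis by (simp add: wxz bw[symmetric])
  qed
  finally have "(w \<otimes>\<^bsub>E\<^esub> c) \<otimes>\<^bsub>E\<^esub> (x \<otimes>\<^bsub>E\<^esub> y) = (c \<otimes>\<^bsub>E\<^esub> w) \<otimes>\<^bsub>E\<^esub> (x \<otimes>\<^bsub>E\<^esub> y)"
    by (simp add: E.m_assoc)
  then show ?thesis
    by simp
qed

text \<open>A section that is a homomorphism has the form
  \<open>g \<mapsto> (inverse (\<phi> g), g)\<close>, and its multiplicativity says that
  \<open>f\<close> is the coboundary of \<open>\<phi>\<close>.\<close>

lemma split_imp_coboundary:
  assumes s: "s \<in> hom G E" and sec: "\<And>g. g \<in> carrier G \<Longrightarrow> snd (s g) = g"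
  shows "f \<in> coboundaries2 G complex_units"
proof -
  define \<phi> where "\<phi> g = inverse (fst (s g))" for g
  have sg: "s g = (inverse (\<phi> g), g)" "\<phi> g \<noteq> 0" if "g \<in> carrier G" for g
    using that sec[OF that] s by (auto simp: \<phi>_def hom_def Pi_iff prod_eq_iff E_simps dest!: bspec)
  have "f (g, h) = \<phi> g * \<phi> h * inverse (\<phi> (g \<otimes> h))" if [simp]: "g \<in> carrier G" "h \<in> carrier G" for g h
  proof -
    have "s (g \<otimes> h) = s g \<otimes>\<^bsub>E\<^esub> s h" using s by (simp add: hom_def)
    then have "inverse (\<phi> (g \<otimes> h)) = inverse (\<phi> g) * inverse (\<phi> h) * f (g, h)"
      by (simp add: sg E_simps)
    then show ?thesis using sg(2)[of g] sg(2)[of h] by (simp add: field_simps)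
  qed
  moreover have "f \<in> extensional (carrier G \<times> carrier G)"
    using f by (auto simp: cocycles2_def cochains2_def PiE_iff)
  ultimately have "f = coboundary2 G complex_units \<phi>"
    by (auto simp: fun_eq_iff coboundary2_def inv_complex_units sg extensional_def)
  then show ?thesis by (auto simp: coboundaries2_def sg)
qed

end

subsection \<open>Heisenberg groups in integral coordinates\<close>

definition single :: "nat \<Rightarrow> int \<Rightarrow> nat \<Rightarrow> int" where
  "single p x = (\<lambda>_. 0)(p := x)"

lemma single_apply: "single p x k = (if k = p then x else 0)"
  by (simp add: single_def)

lemma sum_single:
  "(\<Sum>i=1..n. single p a i * v (n + i)) = (if 1 \<le> p \<and> p \<le> n then a * v (n + p) else 0)"
proof -
  have "(\<Sum>i=1..n. single p a i * v (n + i)) = (\<Sum>i=1..n. if i = p then a * v (n + p) else 0)"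
    by (rule sum.cong) (auto simp: single_apply)
  then show ?thesis by (simp add: sum.delta')
qed

text \<open>Integral coordinates \<open>P\<close> on the group: the modulus \<open>r\<close> enters
  only through \<open>P_eq_iff\<close>, so computations take place over the integers. The assumption
  \<open>parity\<close> merges the two cases of the theorem.\<close>

locale heis_chart = group +
  fixes P :: "(nat \<Rightarrow> int) \<Rightarrow> 'a" and r :: nat and t :: int and n :: nat
  assumes P_range: "carrier G = range P"
    and P_mult: "P v \<otimes> P w = P (heis_mult t n v w)"
    and P_eq_iff: "P v = P w \<longleftrightarrow> (\<forall>k\<le>2 * n. int r dvd v k - w k)"
    and n_pos: "n > 0" and t_nonzero: "t \<noteq> 0" and t_dvd: "t dvd int r"
    and parity: "n > 1 \<or> odd r \<or> r = 0"
begin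

lemma P_closed [simp]: "P v \<in> carrier G"
  by (simp add: P_range)

lemma P_zero: "P (\<lambda>_. 0) = \<one>"
proof -
  have "heis_mult t n (\<lambda>_. 0) (\<lambda>_. 0) = (\<lambda>_. 0)"
    by (auto simp: heis_mult_def)
  then have "P (\<lambda>_. 0) \<otimes> P (\<lambda>_. 0) = P (\<lambda>_. 0)"
    by (simp add: P_mult)
  then show ?thesis by simp
qed

definition gen :: "nat \<Rightarrow> 'a" where "gen p = P (single p 1)"

lemma gen_closed [simp]: "gen p \<in> carrier G"
  by (simp add: gen_def)

lemma heis_mult_single_same: "heis_mult t n (single p a) (single p b) = single p (a + b)"
  using n_pos unfolding heis_mult_def sum_single by (auto simp: fun_eq_iff single_apply)

lemma gen_int_pow: "gen p [^] (k::int) = P (single p k)"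
proof (induction k rule: int_induct[where k = 0])
  case base
  have "single p 0 = (\<lambda>_. 0)" by (auto simp: single_apply)
  then show ?case by (simp add: P_zero)
next
  case (step1 i)
  then show ?case
    by (simp add: int_pow_mult gen_def P_mult heis_mult_single_same)
next
  case (step2 i)
  have "P (single p (i - 1)) \<otimes> gen p = P (single p i)"
    by (simp add: gen_def P_mult heis_mult_single_same)
  then have "P (single p (i - 1)) = P (single p i) \<otimes> inv (gen p)"
    by (simp add: inv_solve_right)
  then show ?case
    using step2 by (simp add: int_pow_diff)
qed

lemma gen_commute:
  assumes "p < q" "\<not> (p > 0 \<and> q = n + p)"
  shows "gen q \<otimes> gen p = gen p \<otimes> gen q"
  unfolding gen_def P_mult
  by (rule arg_cong[where f = P])
    (use assms in \<open>unfold heis_mult_def sum_single, auto simp: fun_eq_iff single_apply\<close>)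

lemma gen_commute':
  assumes "\<not> (p > 0 \<and> q = n + p)" "\<not> (q > 0 \<and> p = n + q)"
  shows "gen q \<otimes> gen p = gen p \<otimes> gen q"
  using gen_commute[of p q] gen_commute[of q p] assms by (cases p q rule: linorder_cases) auto

lemma gen_dual_mult:
  assumes "i > 0" "i \<le> n"
  shows "gen i \<otimes> gen (n + i) = P ((single i 1)(n + i := 1))"
  unfolding gen_def P_mult
  by (rule arg_cong[where f = P])
    (use assms in \<open>unfold heis_mult_def sum_single, auto simp: fun_eq_iff single_apply\<close>)

lemma gen_dual:
  assumes "i > 0" "i \<le> n"
  shows "gen (n + i) \<otimes> gen i = P (single 0 t) \<otimes> (gen i \<otimes> gen (n + i))"
proof -
  have 0: "(\<Sum>j=1..n. w j * single 0 t (n + j)) = 0" for w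
    by (rule sum.neutral) (use n_pos in \<open>auto simp: single_apply\<close>)
  show ?thesis
    unfolding gen_dual_mult[OF assms] unfolding gen_def P_mult
    by (rule arg_cong[where f = P])
      (use assms in \<open>unfold heis_mult_def sum_single 0, auto simp: fun_eq_iff single_apply\<close>)
qed

text \<open>Appending the next generator on the right creates no central term: this would require
  the coordinate \<open>n + Suc k\<close> of the partial product, which is still zero.\<close>

lemma ordered_prod_gen: "ordered_prod G gen (2 * n) v = P v"
proof -
  have "ordered_prod G gen k v = P (\<lambda>i. if i \<le> k then v i else 0)" if "k \<le> 2 * n" for k
    using that
  proof (induction k)
    case 0
    have "single 0 (v 0) = (\<lambda>i. if i \<le> 0 then v i else 0)" by (auto simp: single_apply)
    then show ?case by (simp add: gen_int_pow)
  next
    case (Suc k)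
    have "(\<Sum>i=1..n. single (Suc k) (v (Suc k)) i * (if n + i \<le> k then v (n + i) else 0)) = 0"
      by (rule sum.neutral) (auto simp: single_apply)
    then have "heis_mult t n (\<lambda>i. if i \<le> k then v i else 0) (single (Suc k) (v (Suc k)))
        = (\<lambda>i. if i \<le> Suc k then v i else 0)"
      unfolding heis_mult_def by (auto simp: fun_eq_iff single_apply le_Suc_eq)
    then show ?case
      using Suc by (simp add: gen_int_pow P_mult)
  qed
  from this[of "2 * n"] show ?thesis by (simp add: P_eq_iff)
qed

lemma gen_pow_order: "gen p [^] r = \<one>"
proof -
  have "gen p [^] int r = P (\<lambda>_. 0)"
    unfolding gen_int_pow P_eq_iff by (simp add: single_apply)
  then show ?thesis by (simp add: int_pow_int P_zero)
qed

definition cofactor :: nat where "cofactor = r div nat \<bar>t\<bar>"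

lemma cofactor_times: "cofactor * nat \<bar>t\<bar> = r"
  using t_dvd by (simp add: cofactor_def nat_abs_dvd_iff)

lemma dvd_cofactor: "int r dvd t * int cofactor"
proof -
  have "int r = int cofactor * \<bar>t\<bar>"
    using cofactor_times by (metis abs_ge_zero nat_0_le of_nat_mult)
  then show ?thesis by (simp add: mult.commute)
qed

end

text \<open>
  In a central extension with cocycle \<open>F\<close>, \<open>comm_inv\<close> is the commutator of lifts of two commuting
  generators, \<open>dual_inv i\<close> is the scalar part of \<open>C\<^sub>i = [y\<^sub>i, x\<^sub>i]\<close>, which lies over \<open>z\<^sup>t\<close>, and
  \<open>central_inv m\<close> is \<open>C\<^sub>1\<^sup>m\<close> if \<open>z\<close> has order dividing \<open>t m\<close>.
\<close>

definition comm_inv :: "((nat \<Rightarrow> int) \<Rightarrow> (nat \<Rightarrow> int) \<Rightarrow> complex) \<Rightarrow> nat \<Rightarrow> nat \<Rightarrow> complex" where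
  "comm_inv F p q = F (single q 1) (single p 1) / F (single p 1) (single q 1)"

definition dual_inv ::
    "int \<Rightarrow> nat \<Rightarrow> ((nat \<Rightarrow> int) \<Rightarrow> (nat \<Rightarrow> int) \<Rightarrow> complex) \<Rightarrow> nat \<Rightarrow> complex" where
  "dual_inv t n F i = F (single (n + i) 1) (single i 1) /
    (F (single i 1) (single (n + i) 1) * F (single 0 t) ((single i 1)(n + i := 1)))"

definition central_inv ::
    "int \<Rightarrow> nat \<Rightarrow> nat \<Rightarrow> ((nat \<Rightarrow> int) \<Rightarrow> (nat \<Rightarrow> int) \<Rightarrow> complex) \<Rightarrow> complex" where
  "central_inv t n m F = dual_inv t n F 1 ^ m * (\<Prod>j<m. F (single 0 (t * int j)) (single 0 t))"

text \<open>The quotients by \<open>dual_inv t n F 1\<close> leave the slot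
  \<open>(1, n + 1)\<close> free; it receives the one remaining invariant,
  \<open>central_inv\<close>.\<close>

definition heis_inv ::
    "nat \<Rightarrow> int \<Rightarrow> nat \<Rightarrow> ((nat \<Rightarrow> int) \<Rightarrow> (nat \<Rightarrow> int) \<Rightarrow> complex) \<Rightarrow> nat \<times> nat \<Rightarrow> complex"
  where "heis_inv r t n F = (\<lambda>(p, q).
    if p > 0 \<and> q = n + p
    then if p = 1 then central_inv t n (r div nat \<bar>t\<bar>) F else dual_inv t n F p / dual_inv t n F 1
    else comm_inv F p q)"

definition heis_index :: "nat \<Rightarrow> nat \<Rightarrow> (nat \<times> nat) set" where
  "heis_index r n = {(p, q). p < q \<and> q \<le> 2 * n \<and> (r = 0 \<longrightarrow> (p, q) \<noteq> (1, n + 1))}"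

text \<open>
  For \<open>r = 0\<close> the order \<open>r\<close> imposes no condition, since \<open>u ^ 0 = 1\<close>; the pair \<open>(1, n + 1)\<close> is left out
  above since \<open>0 div m = 0\<close> makes its invariant trivial.
\<close>

definition heis_order :: "nat \<Rightarrow> int \<Rightarrow> nat \<Rightarrow> nat \<times> nat \<Rightarrow> nat" where
  "heis_order r t n = (\<lambda>(p, q).
    if p = 0 then if n = 1 then r else nat \<bar>t\<bar>
    else if p = 1 \<and> q = n + 1 then nat \<bar>t\<bar> else r)"

section \<open>Orders of the invariants of a cocycle\<close>

locale heis_cocycle = heis_chart + cocycle
begin

abbreviation F where "F v w \<equiv> f (P v, P w)"

definition lift :: "nat \<Rightarrow> complex \<times> 'a" where "lift p = (1, gen p)"

definition K :: "nat \<Rightarrow> complex" where "K i = dual_inv t n F i"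

definition C :: "nat \<Rightarrow> complex \<times> 'a" where "C i = (K i, P (single 0 t))"

lemma lift_closed [simp]: "lift p \<in> carrier E"
  by (simp add: lift_def E_simps)

lemma snd_lift [simp]: "snd (lift p) = gen p"
  by (simp add: lift_def)

lemma K_nonzero [simp]: "K i \<noteq> 0"
  by (simp add: K_def dual_inv_def)

lemma C_closed [simp]: "C i \<in> carrier E"
  by (simp add: C_def E_simps)

lemma comm_inv_nonzero [simp]: "comm_inv F p q \<noteq> 0"
  by (simp add: comm_inv_def)

lemma lift_commute:
  assumes "p < q" "\<not> (p > 0 \<and> q = n + p)"
  shows "lift q \<otimes>\<^bsub>E\<^esub> lift p = scal (comm_inv F p q) \<otimes>\<^bsub>E\<^esub> (lift p \<otimes>\<^bsub>E\<^esub> lift q)"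
  using gen_commute[OF assms] by (simp add: lift_def scal_def comm_inv_def gen_def E_simps)

lemma lift_dual:
  assumes "i > 0" "i \<le> n"
  shows "lift (n + i) \<otimes>\<^bsub>E\<^esub> lift i = C i \<otimes>\<^bsub>E\<^esub> (lift i \<otimes>\<^bsub>E\<^esub> lift (n + i))"
  using gen_dual[OF assms] gen_dual_mult[OF assms]
  by (simp add: lift_def C_def K_def dual_inv_def gen_def E_simps)

lemma C_eq_scal: "C i = scal (K i / K j) \<otimes>\<^bsub>E\<^esub> C j"
  by (simp add: C_def scal_def E_simps)

text \<open>The division by \<open>f1\<close> stems from the unit of \<open>E\<close> at exponent 0.
  Once the second component is trivial, \<open>scal\<close> absorbs it, which is why
  \<open>f1\<close> does not occur in \<open>central_inv\<close>.\<close>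

lemma C_nat_pow:
  "C i [^]\<^bsub>E\<^esub> (k::nat)
    = (K i ^ k * (\<Prod>j<k. F (single 0 (t * int j)) (single 0 t)) / f1, P (single 0 (t * int k)))"
proof (induction k)
  case 0
  have "single 0 0 = (\<lambda>_. 0)" by (auto simp: single_apply)
  then show ?case by (simp add: P_zero E_simps)
next
  case (Suc k)
  then show ?case
    by (simp add: C_def P_mult heis_mult_single_same E_simps algebra_simps)
qed

lemma C_pow_cofactor: "C 1 [^]\<^bsub>E\<^esub> cofactor = scal (central_inv t n cofactor F)"
proof -
  have "P (single 0 (t * int cofactor)) = P (\<lambda>_. 0)"
    unfolding P_eq_iff by (simp add: single_apply dvd_cofactor)
  then show ?thesis
    by (simp add: C_nat_pow central_inv_def scal_def K_def P_zero)
qed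

lemma lift_pow_order:
  obtains u where "u \<noteq> 0" "lift p [^]\<^bsub>E\<^esub> r = scal u"
  using snd_one[of "lift p [^]\<^bsub>E\<^esub> r"]
  by (metis E.nat_pow_closed gen_pow_order lift_closed snd_lift snd_nat_pow)

text \<open>The commutator of \<open>y\<close> with the r-th power of the lift is
  \<open>u ^ r\<close>, but that power is a scalar and therefore central.\<close>

lemma commutator_pow_order:
  assumes [simp]: "y \<in> carrier E" "u \<noteq> 0"
    and "y \<otimes>\<^bsub>E\<^esub> lift p = scal u \<otimes>\<^bsub>E\<^esub> (lift p \<otimes>\<^bsub>E\<^esub> y)"
  shows "u ^ r = 1"
proof -
  obtain v where v: "v \<noteq> 0" "lift p [^]\<^bsub>E\<^esub> r = scal v" by (rule lift_pow_order)
  have "y \<otimes>\<^bsub>E\<^esub> scal v = scal (u ^ r) \<otimes>\<^bsub>E\<^esub> (scal v \<otimes>\<^bsub>E\<^esub> y)"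
    using scal_commutator_int_pow[of "lift p" y u "int r"] assms v
    by (simp add: int_pow_int)
  then have "scal (u ^ r) \<otimes>\<^bsub>E\<^esub> (scal v \<otimes>\<^bsub>E\<^esub> y) = scal v \<otimes>\<^bsub>E\<^esub> y"
    by (simp add: scal_commute)
  then show ?thesis
    using v by (intro scal_cancel[of "scal v \<otimes>\<^bsub>E\<^esub> y"]) auto
qed

lemma comm_inv_order:
  assumes "p < q" "\<not> (p > 0 \<and> q = n + p)"
  shows "comm_inv F p q ^ r = 1"
  by (rule commutator_pow_order[OF _ _ lift_commute[OF assms]]) auto

lemma lift0_pow_C: obtains u where "u \<noteq> 0" "lift 0 [^]\<^bsub>E\<^esub> t = scal u \<otimes>\<^bsub>E\<^esub> C i"
proof -
  have "snd (lift 0 [^]\<^bsub>E\<^esub> t) = snd (C i)"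
    by (simp add: snd_int_pow gen_int_pow C_def)
  then show ?thesis
    by (rule same_snd[rotated 2]) (auto intro: that)
qed

text \<open>Up to a scalar \<open>C i\<close> is the t-th power of \<open>lift 0\<close>, so the
  commutator of \<open>lift q\<close> with \<open>lift 0\<close> is raised to the power
  \<open>t\<close>.\<close>

lemma lift_C_commute:
  assumes "q > 0"
  shows "lift q \<otimes>\<^bsub>E\<^esub> C i = scal (comm_inv F 0 q powi t) \<otimes>\<^bsub>E\<^esub> (C i \<otimes>\<^bsub>E\<^esub> lift q)"
proof -
  obtain u where u: "u \<noteq> 0" and C: "lift 0 [^]\<^bsub>E\<^esub> t = scal u \<otimes>\<^bsub>E\<^esub> C i" by (rule lift0_pow_C)
  let ?c = "comm_inv F 0 q powi t"
  have "lift q \<otimes>\<^bsub>E\<^esub> (scal u \<otimes>\<^bsub>E\<^esub> C i) = scal ?c \<otimes>\<^bsub>E\<^esub> ((scal u \<otimes>\<^bsub>E\<^esub> C i) \<otimes>\<^bsub>E\<^esub> lift q)"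
    using scal_commutator_int_pow[OF _ _ _ lift_commute[of 0 q], of t] assms
    by (simp add: C[symmetric])
  then have "scal u \<otimes>\<^bsub>E\<^esub> (lift q \<otimes>\<^bsub>E\<^esub> C i) = scal u \<otimes>\<^bsub>E\<^esub> (scal ?c \<otimes>\<^bsub>E\<^esub> (C i \<otimes>\<^bsub>E\<^esub> lift q))"
    using u by (simp add: E.m_assoc scal_left_commute[of "lift q" _ u] scal_left_commute[of "scal ?c" _ u])
  then show ?thesis
    using u by simp
qed

lemma central_comm_inv_powi:
  assumes "q > 0" "q \<le> 2 * n" "n > 1"
  shows "comm_inv F 0 q powi t = 1"
proof -
  \<comment> \<open>A dual pair not containing the generator \<open>q\<close>; one of the first two
    pairs will do. Both its members commute with \<open>gen q\<close>, as
    \<open>commute_commutator\<close> requires.\<close>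
  obtain i where i: "i > 0" "i \<le> n" "q \<noteq> i" "q \<noteq> n + i"
  proof (cases "q = 1 \<or> q = n + 1")
    case True
    then show ?thesis using that[of 2] assms by auto
  next
    case False
    then show ?thesis using that[of 1] assms by auto
  qed
  have "lift q \<otimes>\<^bsub>E\<^esub> C i = C i \<otimes>\<^bsub>E\<^esub> lift q"
    using i assms
    by (intro commute_commutator[OF _ _ _ _ lift_dual]) (auto intro!: gen_commute')
  then have "scal (comm_inv F 0 q powi t) \<otimes>\<^bsub>E\<^esub> (C i \<otimes>\<^bsub>E\<^esub> lift q) = C i \<otimes>\<^bsub>E\<^esub> lift q"
    using lift_C_commute[of q i] assms(1) by simp
  then show ?thesis
    by (intro scal_cancel[of "C i \<otimes>\<^bsub>E\<^esub> lift q"]) auto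
qed

lemma powi_eq_one_abs: "(u::complex) powi t = 1 \<Longrightarrow> u ^ nat \<bar>t\<bar> = 1"
  by (cases t rule: int_cases2) (auto simp: power_int_minus)

text \<open>Let x and y be the lifts of the dual pair. Conjugation by y turns x into
  \<open>C i\<close> x but fixes the scalar x^r, so (\<open>C i\<close> x)^r = x^r. Collecting the
  factors gives (\<open>C i\<close> x)^r = w^(r choose 2) \<open>C i\<close>^r x^r, and the power of
  w is trivial.\<close>

lemma C_pow_order:
  assumes i: "i > 0" "i \<le> n"
  shows "C i [^]\<^bsub>E\<^esub> r = \<one>\<^bsub>E\<^esub>"
proof -
  let ?x = "lift i" and ?y = "lift (n + i)" and ?w = "comm_inv F 0 i powi t"
  have "?w ^ (r choose 2) = 1"
  proof (cases "n > 1")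
    case True
    then show ?thesis using central_comm_inv_powi[of i] i by simp
  next
    case False
    have "comm_inv F 0 i ^ r = 1"
      using comm_inv_order[of 0 i] i by simp
    then have w: "?w ^ r = 1"
      by (metis power_int_1_left power_int_mult power_int_of_nat mult.commute)
    from False consider "odd r" | "r = 0" using parity by blast
    then show ?thesis
    proof cases
      case 1
      \<comment> \<open>For odd \<open>r\<close> the number \<open>(r - 1) / 2\<close> is integral,
        so \<open>r\<close> divides \<open>r choose 2\<close>.\<close>
      then have "r choose 2 = r * ((r - 1) div 2)"
        by (simp add: choose_two div_mult_swap)
      then show ?thesis by (simp add: power_mult w)
    qed (simp add: numeral_2_eq_2)
  qed
  moreover have "(C i \<otimes>\<^bsub>E\<^esub> ?x) [^]\<^bsub>E\<^esub> r
      = scal ?w [^]\<^bsub>E\<^esub> (r choose 2) \<otimes>\<^bsub>E\<^esub> (C i [^]\<^bsub>E\<^esub> r \<otimes>\<^bsub>E\<^esub> ?x [^]\<^bsub>E\<^esub> r)"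
    using lift_C_commute[of i i] i
    by (intro E.mult_nat_pow_commutator) (auto simp: scal_commute)
  ultimately have "(C i \<otimes>\<^bsub>E\<^esub> ?x) [^]\<^bsub>E\<^esub> r = C i [^]\<^bsub>E\<^esub> r \<otimes>\<^bsub>E\<^esub> ?x [^]\<^bsub>E\<^esub> r"
    by (simp add: scal_nat_pow)
  moreover have "(C i \<otimes>\<^bsub>E\<^esub> ?x) [^]\<^bsub>E\<^esub> r = ?x [^]\<^bsub>E\<^esub> r"
  proof -
    obtain u where u: "u \<noteq> 0" "?x [^]\<^bsub>E\<^esub> r = scal u" by (rule lift_pow_order)
    have hom: "(\<lambda>g. ?y \<otimes>\<^bsub>E\<^esub> g \<otimes>\<^bsub>E\<^esub> inv\<^bsub>E\<^esub> ?y) \<in> hom E E"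
      by (auto simp: hom_def E.m_assoc E.inv_solve_left)
    have "C i \<otimes>\<^bsub>E\<^esub> ?x = ?y \<otimes>\<^bsub>E\<^esub> ?x \<otimes>\<^bsub>E\<^esub> inv\<^bsub>E\<^esub> ?y"
      by (simp add: lift_dual i E.m_assoc)
    then have "(C i \<otimes>\<^bsub>E\<^esub> ?x) [^]\<^bsub>E\<^esub> int r = ?y \<otimes>\<^bsub>E\<^esub> ?x [^]\<^bsub>E\<^esub> int r \<otimes>\<^bsub>E\<^esub> inv\<^bsub>E\<^esub> ?y"
      using hom_int_pow[OF hom lift_closed group_E group_E, of i "int r"] by simp
    then show ?thesis
      using u by (simp add: int_pow_int scal_commute E.m_assoc)
  qed
  ultimately show ?thesis
    by simp
qed

text \<open>For dual pairs everything rests on \<open>C_pow_order\<close>: since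
  \<open>cofactor * nat \<bar>t\<bar> = r\<close>, the invariant at \<open>(1, n + 1)\<close> raised
  to \<open>nat \<bar>t\<bar>\<close> gives the r-th power of \<open>C 1\<close>; for other p, both
  \<open>C p\<close> and \<open>C 1\<close> are killed by \<open>r\<close>, hence so is their scalar
  quotient.\<close>

theorem heis_inv_order:
  assumes "(p, q) \<in> heis_index r n"
  shows "heis_inv r t n F (p, q) ^ heis_order r t n (p, q) = 1"
proof -
  have pq: "p < q" "q \<le> 2 * n" using assms by (auto simp: heis_index_def)
  show ?thesis
  proof (cases "p > 0 \<and> q = n + p")
    case False
    then have inv: "heis_inv r t n F (p, q) = comm_inv F p q"
      by (auto simp: heis_inv_def)
    show ?thesis
    proof (cases "p = 0 \<and> n > 1")
      case True
      then have "comm_inv F 0 q powi t = 1"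
        using pq by (intro central_comm_inv_powi) auto
      then show ?thesis
        using True inv powi_eq_one_abs by (simp add: heis_order_def)
    next
      case F: False
      then have "heis_order r t n (p, q) = r"
        using False n_pos by (auto simp: heis_order_def)
      then show ?thesis using comm_inv_order[of p q] False pq inv by simp
    qed
  next
    case True
    then have p: "p > 0" "p \<le> n" "q = n + p" using pq by auto
    have C1: "C 1 [^]\<^bsub>E\<^esub> r = \<one>\<^bsub>E\<^esub>"
      using n_pos by (intro C_pow_order) auto
    show ?thesis
    proof (cases "p = 1")
      case True
      have "scal (central_inv t n cofactor F ^ nat \<bar>t\<bar>) = (C 1 [^]\<^bsub>E\<^esub> cofactor) [^]\<^bsub>E\<^esub> nat \<bar>t\<bar>"
      proof -
        have "central_inv t n cofactor F \<noteq> 0"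
          using K_nonzero[of 1] by (simp add: central_inv_def K_def)
        then show ?thesis by (simp only: C_pow_cofactor scal_nat_pow not_False_eq_True)
      qed
      also have "\<dots> = \<one>\<^bsub>E\<^esub>"
        by (simp only: E.nat_pow_pow C_closed cofactor_times C1)
      finally have "central_inv t n cofactor F ^ nat \<bar>t\<bar> = 1"
        by (simp only: scal_eq_one_iff)
      then show ?thesis
        using True p by (simp add: heis_inv_def heis_order_def cofactor_def)
    next
      case False
      have "(scal (K p / K 1) \<otimes>\<^bsub>E\<^esub> C 1) [^]\<^bsub>E\<^esub> r = \<one>\<^bsub>E\<^esub>"
        using C_pow_order[of p] p C_eq_scal[of p 1] by simp
      then have "scal (K p / K 1) [^]\<^bsub>E\<^esub> r \<otimes>\<^bsub>E\<^esub> C 1 [^]\<^bsub>E\<^esub> r = \<one>\<^bsub>E\<^esub>"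
        by (subst (asm) E.pow_mult_distrib) (auto simp: scal_commute)
      then have "scal ((K p / K 1) ^ r) = \<one>\<^bsub>E\<^esub>"
        by (simp add: scal_nat_pow C1 del: One_nat_def)
      then have "(K p / K 1) ^ r = 1"
        by (simp only: scal_eq_one_iff)
      then show ?thesis
        using False p by (simp add: heis_inv_def heis_order_def K_def)
    qed
  qed
qed

end

section \<open>Roots of complex scalars and the splitting of the extension\<close>

lemma complex_root_exists:
  assumes "k > 0" "c \<noteq> 0"
  obtains a :: complex where "a \<noteq> 0" "a ^ k = c"
proof -
  let ?a = "rcis (root k (norm c)) (Arg c / k)"
  have "?a ^ k = c"
    using assms by (simp add: DeMoivre2 rcis_cmod_Arg)
  then show ?thesis
    using assms by (intro that[of ?a]) auto
qed

lemma complex_int_root_exists: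
  assumes "k \<noteq> 0" "c \<noteq> 0"
  obtains a :: complex where "a \<noteq> 0" "a powi k = c"
proof (cases "k > 0")
  case True
  then obtain a where "a \<noteq> 0" "a ^ nat k = c"
    using complex_root_exists[of "nat k" c] assms by auto
  then show ?thesis
    using True that by (simp add: power_int_def)
next
  case False
  then obtain a where "a \<noteq> 0" "a ^ nat (- k) = inverse c"
    using complex_root_exists[of "nat (- k)" "inverse c"] assms by auto
  then show ?thesis
    using False assms that by (simp add: power_int_def power_inverse)
qed

context cocycle
begin

lemma scal_mult_int_pow:
  assumes "x \<in> carrier E" "u \<noteq> 0"
  shows "(scal u \<otimes>\<^bsub>E\<^esub> x) [^]\<^bsub>E\<^esub> (k::int) = scal (u powi k) \<otimes>\<^bsub>E\<^esub> x [^]\<^bsub>E\<^esub> k"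
  using assms by (simp add: E.int_pow_mult_distrib scal_commute scal_int_pow)

text \<open>Rescaling the lifts by central scalars leaves their commutator unchanged, so powers can
  be adjusted without spoiling the commutation relations.\<close>

lemma scale_commutator:
  assumes [simp]: "x \<in> carrier E" "y \<in> carrier E" "c \<in> carrier E" "u \<noteq> 0" "v \<noteq> 0"
    and yx: "y \<otimes>\<^bsub>E\<^esub> x = c \<otimes>\<^bsub>E\<^esub> (x \<otimes>\<^bsub>E\<^esub> y)"
  shows "(scal u \<otimes>\<^bsub>E\<^esub> y) \<otimes>\<^bsub>E\<^esub> (scal v \<otimes>\<^bsub>E\<^esub> x)
    = c \<otimes>\<^bsub>E\<^esub> ((scal v \<otimes>\<^bsub>E\<^esub> x) \<otimes>\<^bsub>E\<^esub> (scal u \<otimes>\<^bsub>E\<^esub> y))"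
proof -
  have "(scal u \<otimes>\<^bsub>E\<^esub> y) \<otimes>\<^bsub>E\<^esub> (scal v \<otimes>\<^bsub>E\<^esub> x) = scal u \<otimes>\<^bsub>E\<^esub> (scal v \<otimes>\<^bsub>E\<^esub> (y \<otimes>\<^bsub>E\<^esub> x))"
    by (simp add: E.m_assoc scal_left_commute[of y _ v])
  also have "\<dots> = c \<otimes>\<^bsub>E\<^esub> (scal u \<otimes>\<^bsub>E\<^esub> (scal v \<otimes>\<^bsub>E\<^esub> (x \<otimes>\<^bsub>E\<^esub> y)))"
    unfolding yx by (simp add: scal_left_commute[of c _ u] scal_left_commute[of c _ v])
  also have "scal u \<otimes>\<^bsub>E\<^esub> (scal v \<otimes>\<^bsub>E\<^esub> (x \<otimes>\<^bsub>E\<^esub> y)) = (scal v \<otimes>\<^bsub>E\<^esub> x) \<otimes>\<^bsub>E\<^esub> (scal u \<otimes>\<^bsub>E\<^esub> y)"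
    by (simp add: E.m_assoc scal_left_commute[of x _ u] scal_left_commute[of "scal v" _ u])
  finally show ?thesis .
qed

end

context heis_cocycle
begin

lemma snd_ordered_prod:
  assumes "\<And>p. p \<le> k \<Longrightarrow> W p \<in> carrier E \<and> snd (W p) = gen p"
  shows "ordered_prod E W k v \<in> carrier E \<and> snd (ordered_prod E W k v) = ordered_prod G gen k v"
  using assms
proof (induction k)
  case 0
  then show ?case by (auto simp: snd_int_pow)
next
  case (Suc k)
  then have "ordered_prod E W k v \<in> carrier E \<and> snd (ordered_prod E W k v) = ordered_prod G gen k v"
    and "W (Suc k) \<in> carrier E \<and> snd (W (Suc k)) = gen (Suc k)"
    by auto
  then show ?case
    using snd_hom by (auto simp: hom_def snd_int_pow)
qed

text \<open>Suitably rescaled lifts \<open>W\<close> satisfy the commutation relations and have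
  trivial r-th power. Ordered products in them then depend only on the group element and form a
  homomorphic section.\<close>

theorem heis_inv_trivial_imp_coboundary:
  assumes triv: "\<And>p q. (p, q) \<in> heis_index r n \<Longrightarrow> heis_inv r t n F (p, q) = 1"
  shows "f \<in> coboundaries2 G complex_units"
proof -
  have comm1: "comm_inv F p q = 1" if "p < q" "q \<le> 2 * n" "\<not> (p > 0 \<and> q = n + p)" for p q
    using triv[of p q] that by (auto simp: heis_inv_def heis_index_def)
  have dual1: "C i = C 1" if "i > 0" "i \<le> n" for i
  proof (cases "i = 1")
    case False
    then have "K i / K 1 = 1"
      using triv[of i "n + i"] that by (auto simp: heis_inv_def heis_index_def K_def)
    then show ?thesis using C_eq_scal[of i 1] by simp
  qed simp
  have C1: "C 1 [^]\<^bsub>E\<^esub> cofactor = \<one>\<^bsub>E\<^esub>"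
  proof (cases "r = 0")
    case True
    then show ?thesis unfolding cofactor_def by simp
  next
    case False
    then have "central_inv t n cofactor F = 1"
      using triv[of 1 "n + 1"] n_pos by (auto simp: heis_inv_def heis_index_def cofactor_def)
    then show ?thesis using C_pow_cofactor by simp
  qed
  \<comment> \<open>For \<open>p = 0\<close> a t-th root adjusts the t-th power to
    \<open>C 1\<close>, and then the r-th power is trivial by \<open>C1\<close>. For the other
    generators an r-th root suffices; if \<open>r = 0\<close> no adjustment is made.\<close>
  have "\<exists>u. u \<noteq> 0 \<and> (scal u \<otimes>\<^bsub>E\<^esub> lift p) [^]\<^bsub>E\<^esub> int r = \<one>\<^bsub>E\<^esub>
      \<and> (p = 0 \<longrightarrow> (scal u \<otimes>\<^bsub>E\<^esub> lift p) [^]\<^bsub>E\<^esub> t = C 1)" for p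
  proof (cases "p = 0")
    case True
    obtain b where b: "b \<noteq> 0" "lift 0 [^]\<^bsub>E\<^esub> t = scal b \<otimes>\<^bsub>E\<^esub> C 1" by (rule lift0_pow_C)
    obtain u where u: "u \<noteq> 0" "u powi t = inverse b"
      using complex_int_root_exists[OF t_nonzero, of "inverse b"] b by auto
    let ?z = "scal u \<otimes>\<^bsub>E\<^esub> lift 0"
    have z: "?z [^]\<^bsub>E\<^esub> t = C 1"
      using b u by (simp add: scal_mult_int_pow E.m_assoc[symmetric] scal_mult)
    \<comment> \<open>The sign is needed because \<open>t\<close> may be negative while
      \<open>cofactor\<close> is defined from its absolute value.\<close>
    have "int r = t * (sgn t * int cofactor)"
    proof -
      have "int r = int cofactor * \<bar>t\<bar>"
        using cofactor_times by (metis abs_ge_zero nat_0_le of_nat_mult)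
      then show ?thesis by (simp add: abs_sgn ac_simps)
    qed
    then have "?z [^]\<^bsub>E\<^esub> int r = (?z [^]\<^bsub>E\<^esub> t) [^]\<^bsub>E\<^esub> (int cofactor * sgn t)"
      using u by (subst E.int_pow_pow) (auto simp: mult.commute)
    also have "\<dots> = (C 1 [^]\<^bsub>E\<^esub> cofactor) [^]\<^bsub>E\<^esub> sgn t"
      unfolding z by (simp only: int_pow_int[symmetric] E.int_pow_pow C_closed)
    finally have "?z [^]\<^bsub>E\<^esub> int r = \<one>\<^bsub>E\<^esub>" by (simp only: C1 E.int_pow_one)
    then show ?thesis using u z True by auto
  next
    case False
    obtain b where b: "b \<noteq> 0" "lift p [^]\<^bsub>E\<^esub> r = scal b" by (rule lift_pow_order)
    show ?thesis
    proof (cases "r = 0")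
      case True
      then show ?thesis using \<open>p \<noteq> 0\<close> by (intro exI[of _ 1]) auto
    next
      case False
      then obtain u where "u \<noteq> 0" "u ^ r = inverse b"
        using complex_root_exists[of r "inverse b"] b by auto
      then have "(scal u \<otimes>\<^bsub>E\<^esub> lift p) [^]\<^bsub>E\<^esub> int r = \<one>\<^bsub>E\<^esub>"
        using b by (subst scal_mult_int_pow) (auto simp: scal_mult int_pow_int)
      then show ?thesis using \<open>u \<noteq> 0\<close> \<open>p \<noteq> 0\<close> by blast
    qed
  qed
  then obtain u where u: "\<And>p. u p \<noteq> 0" "\<And>p. (scal (u p) \<otimes>\<^bsub>E\<^esub> lift p) [^]\<^bsub>E\<^esub> int r = \<one>\<^bsub>E\<^esub>"
      "(scal (u 0) \<otimes>\<^bsub>E\<^esub> lift 0) [^]\<^bsub>E\<^esub> t = C 1"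
    by metis
  define W where "W p = scal (u p) \<otimes>\<^bsub>E\<^esub> lift p" for p
  have W_closed: "W p \<in> carrier E" for p
    using u by (simp add: W_def)
  have W_r: "W p [^]\<^bsub>E\<^esub> int r = \<one>\<^bsub>E\<^esub>" and W_t: "W 0 [^]\<^bsub>E\<^esub> t = C 1" for p
    using u by (simp_all add: W_def)
  interpret W: heis_relations E W t n
  proof unfold_locales
    fix p q :: nat assume pq: "p < q" "q \<le> 2 * n"
    show "W q \<otimes>\<^bsub>E\<^esub> W p = (if p > 0 \<and> q = n + p then W 0 [^]\<^bsub>E\<^esub> t else \<one>\<^bsub>E\<^esub>) \<otimes>\<^bsub>E\<^esub> (W p \<otimes>\<^bsub>E\<^esub> W q)"
    proof (cases "p > 0 \<and> q = n + p")
      case True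
      then have "lift q \<otimes>\<^bsub>E\<^esub> lift p = C 1 \<otimes>\<^bsub>E\<^esub> (lift p \<otimes>\<^bsub>E\<^esub> lift q)"
        using lift_dual[of p] dual1[of p] pq by simp
      then show ?thesis
        using True u W_t scale_commutator[of "lift p" "lift q" "C 1" "u q" "u p"]
        by (simp add: W_def)
    next
      case False
      then have "lift q \<otimes>\<^bsub>E\<^esub> lift p = \<one>\<^bsub>E\<^esub> \<otimes>\<^bsub>E\<^esub> (lift p \<otimes>\<^bsub>E\<^esub> lift q)"
        using lift_commute[of p q] comm1[of p q] pq by simp
      then show ?thesis
        using False u scale_commutator[of "lift p" "lift q" "\<one>\<^bsub>E\<^esub>" "u q" "u p"]
        by (auto simp: W_def)
    qed
  qed (simp add: W_closed)
  have W_cong: "W p [^]\<^bsub>E\<^esub> a = W p [^]\<^bsub>E\<^esub> b" if r_dvd: "int r dvd a - b" for a b :: int and p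
  proof -
    obtain k where "a - b = int r * k" using r_dvd by (elim dvdE)
    then have "a = int r * k + b" by simp
    then show ?thesis
      by (simp only: E.int_pow_mult E.int_pow_pow[symmetric] W_closed W_r E.int_pow_one)
        (simp add: W_closed)
  qed
  \<comment> \<open>This makes the section \<open>s\<close> below independent of the chosen
    representatives.\<close>
  have S_cong: "W.S (2 * n) v = W.S (2 * n) w" if "P v = P w" for v w
  proof -
    have "W.S k v = W.S k w" if "k \<le> 2 * n" for k
      using that
    proof (induction k)
      case 0
      have "W 0 [^]\<^bsub>E\<^esub> v 0 = W 0 [^]\<^bsub>E\<^esub> w 0"
        using \<open>P v = P w\<close> by (intro W_cong) (simp add: P_eq_iff)
      then show ?case by simp
    next
      case (Suc k)
      have "W (Suc k) [^]\<^bsub>E\<^esub> v (Suc k) = W (Suc k) [^]\<^bsub>E\<^esub> w (Suc k)"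
        using \<open>P v = P w\<close> Suc.prems by (intro W_cong) (simp add: P_eq_iff)
      then show ?case using Suc by simp
    qed
    then show ?thesis by simp
  qed
  define s where "s g = W.S (2 * n) (SOME v. P v = g)" for g
  have s_P: "s (P v) = W.S (2 * n) v" for v
    unfolding s_def by (rule S_cong, rule someI_ex[of "\<lambda>w. P w = P v"]) blast
  show ?thesis
  proof (rule split_imp_coboundary[where s = s])
    show "s \<in> hom G E"
      by (auto simp: hom_def P_range s_P P_mult W.ordered_prod_hom)
    have "snd (W p) = gen p" for p
      using u snd_hom by (simp add: W_def scal_def lift_def E_simps)
    then show "snd (s g) = g" if "g \<in> carrier G" for g
      using that snd_ordered_prod[of "2 * n" W] ordered_prod_gen W_closed
      by (auto simp: P_range s_P)
  qed
qed

end

subsection \<open>Realising all invariants\<close>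

lemma comm_inv_mult: "comm_inv (\<lambda>v w. F v w * F' v w) p q = comm_inv F p q * comm_inv F' p q"
  by (simp add: comm_inv_def)

lemma dual_inv_mult: "dual_inv t n (\<lambda>v w. F v w * F' v w) i = dual_inv t n F i * dual_inv t n F' i"
  by (simp add: dual_inv_def mult_ac)

lemma central_inv_mult:
  "central_inv t n m (\<lambda>v w. F v w * F' v w) = central_inv t n m F * central_inv t n m F'"
  by (simp add: central_inv_def dual_inv_mult prod.distrib power_mult_distrib mult_ac)

lemma heis_inv_mult:
  "heis_inv r t n (\<lambda>v w. F v w * F' v w) pq = heis_inv r t n F pq * heis_inv r t n F' pq"
  by (simp add: heis_inv_def comm_inv_mult dual_inv_mult central_inv_mult split: prod.split)

lemma heis_inv_prod:
  assumes "finite A"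
  shows "heis_inv r t n (\<lambda>v w. \<Prod>k\<in>A. F k v w) pq = (\<Prod>k\<in>A. heis_inv r t n (F k) pq)"
  using assms
proof (induction A rule: finite_induct)
  case empty
  then show ?case
    by (simp add: heis_inv_def central_inv_def dual_inv_def comm_inv_def split: prod.split)
next
  case (insert k A)
  then show ?case by (simp add: heis_inv_mult)
qed

context heis_chart
begin

text \<open>For a coboundary of \<open>\<phi>\<close> the quotient at a commuting pair cancels, each
  \<open>dual_inv\<close> is the reciprocal of \<open>\<phi>\<close> at
  \<open>P (single 0 t)\<close>, the same for all i, and the product in \<open>central_inv\<close>
  telescopes to the compensating power.\<close>

lemma coboundary_imp_heis_inv_trivial:
  assumes f: "f \<in> coboundaries2 G complex_units" and pq: "(p, q) \<in> heis_index r n"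
  shows "heis_inv r t n (\<lambda>v w. f (P v, P w)) (p, q) = 1"
proof -
  obtain \<phi> where "\<phi> \<in> carrier G \<rightarrow> - {0}" and f: "f = coboundary2 G complex_units \<phi>"
    using f by (auto simp: coboundaries2_def)
  then have \<phi>: "\<phi> (P v) \<noteq> 0" for v by auto
  have F: "f (P v, P w) = \<phi> (P v) * \<phi> (P w) / \<phi> (P v \<otimes> P w)" for v w
    using \<phi> by (simp add: f coboundary2_def inv_complex_units P_mult divide_inverse)
  have \<phi>_mult: "\<phi> (P v \<otimes> P w) \<noteq> 0" for v w using \<phi> by (simp add: P_mult)
  let ?F = "\<lambda>v w. f (P v, P w)"
  have dual: "dual_inv t n ?F i = 1 / \<phi> (P (single 0 t))" if "i > 0" "i \<le> n" for i
  proof -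
    note xy = gen_dual_mult[OF that, unfolded gen_def]
    show ?thesis
      using gen_dual[OF that, unfolded gen_def xy] \<phi> \<phi>_mult
      by (simp add: dual_inv_def F xy)
  qed
  have comm: "comm_inv ?F p q = 1" if "\<not> (p > 0 \<and> q = n + p)"
    using gen_commute[of p q] pq that \<phi> \<phi>_mult
    by (simp add: comm_inv_def F gen_def heis_index_def)
  have prod: "(\<Prod>j<m. ?F (single 0 (t * int j)) (single 0 t))
      = \<phi> (P (single 0 t)) ^ m * \<phi> \<one> / \<phi> (P (single 0 (t * int m)))" for m
  proof (induction m)
    case 0
    have "single 0 0 = (\<lambda>_. 0)" by (auto simp: single_apply)
    then show ?case using \<phi>[of "\<lambda>_. 0"] by (simp add: P_zero)
  next
    case (Suc m)
    have "P (single 0 (t * int m)) \<otimes> P (single 0 t) = P (single 0 (t * int (Suc m)))"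
      by (simp add: P_mult heis_mult_single_same algebra_simps)
    then show ?case using Suc \<phi> by (simp add: F)
  qed
  have "central_inv t n cofactor ?F = 1"
  proof -
    have "P (single 0 (t * int cofactor)) = P (\<lambda>_. 0)"
      unfolding P_eq_iff by (simp add: single_apply dvd_cofactor)
    then show ?thesis
      unfolding central_inv_def prod using dual[of 1] n_pos \<phi> \<phi>[of "\<lambda>_. 0"]
      by (simp add: P_zero power_divide)
  qed
  then show ?thesis
    using pq comm dual[of p] dual[of 1] n_pos \<phi>
    by (auto simp: heis_inv_def cofactor_def heis_index_def)
qed

lemma cocycle_of_chart:
  fixes F :: "(nat \<Rightarrow> int) \<Rightarrow> (nat \<Rightarrow> int) \<Rightarrow> complex"
  assumes nz: "\<And>v w. F v w \<noteq> 0"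
    and cong: "\<And>v w v' w'. P v = P v' \<Longrightarrow> P w = P w' \<Longrightarrow> F v w = F v' w'"
    and cocycle: "\<And>v w u. F v w * F (heis_mult t n v w) u = F w u * F v (heis_mult t n w u)"
  obtains f where "f \<in> cocycles2 G complex_units" "\<And>v w. f (P v, P w) = F v w"
proof -
  define rep where "rep g = (SOME v. P v = g)" for g
  have rep: "P (rep (P v)) = P v" for v
    unfolding rep_def by (rule someI_ex[of "\<lambda>w. P w = P v"]) blast
  define f where "f = (\<lambda>(g, h)\<in>carrier G \<times> carrier G. F (rep g) (rep h))"
  have f: "f (P v, P w) = F v w" for v w
    using cong[OF rep rep, of v w] by (simp add: f_def)
  have "f \<in> carrier (cochains2 G complex_units)"
    using nz by (auto simp: cochains2_def f_def)
  moreover have "f (x, y) * f (x \<otimes> y, z) = f (y, z) * f (x, y \<otimes> z)"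
    if "x \<in> carrier G" "y \<in> carrier G" "z \<in> carrier G" for x y z
    using that by (auto simp: P_range f P_mult cocycle)
  ultimately have "f \<in> cocycles2 G complex_units"
    by (auto simp: cocycles2_def)
  then show ?thesis using f that by blast
qed

end

section \<open>Standard cocycles given by integral exponents\<close>

definition tri :: "int \<Rightarrow> int" where "tri x = x * (x - 1) div 2"

lemma two_tri: "2 * tri x = x * (x - 1)"
  by (simp add: tri_def)

text \<open>The mixed term \<open>x * y\<close> is what cancels the non-additivity of the first
  coordinate in \<open>std_exp_cocycle\<close>.\<close>

lemma tri_add: "tri (x + y) = tri x + tri y + x * y"
proof -
  have "2 * tri (x + y) = 2 * (tri x + tri y + x * y)"
    unfolding distrib_left two_tri by (simp add: algebra_simps)
  then show ?thesis by simp
qed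

lemma tri_01 [simp]: "tri 0 = 0" "tri 1 = 0"
  by (simp_all add: tri_def)

text \<open>For odd \<open>r\<close> the denominator 2 of \<open>tri\<close> is invertible modulo
  \<open>r\<close>.\<close>

lemma tri_cong:
  assumes "odd r \<or> r = 0" "int r dvd x - y"
  shows "int r dvd tri x - tri y"
proof (cases "r = 0")
  case True
  then show ?thesis using assms by simp
next
  case False
  have "2 * (tri x - tri y) = (x - y) * (x + y - 1)"
    unfolding right_diff_distrib two_tri by (simp add: algebra_simps)
  then have "int r dvd 2 * (tri x - tri y)" using assms by simp
  moreover have "coprime (int r) 2" using False assms by simp
  ultimately show ?thesis by (metis coprime_dvd_mult_right_iff)
qed

lemma dvd_diff_mult_cong:
  fixes d :: int
  assumes "d dvd x - x'" "d dvd y - y'"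
  shows "d dvd x * y - x' * y'"
proof -
  have "x * y - x' * y' = x * (y - y') + (x - x') * y'" by (simp add: algebra_simps)
  then show ?thesis using assms by simp
qed

lemma powi_cong:
  fixes u :: complex
  assumes "u \<noteq> 0" "u ^ k = 1" "int k dvd a - b"
  shows "u powi a = u powi b"
proof -
  obtain c where "a - b = int k * c" using assms(3) by (elim dvdE)
  then have "a = int k * c + b" by simp
  then show ?thesis using assms(1,2) by (simp add: power_int_add power_int_mult)
qed

text \<open>
  The first coordinate is additive only up to \<open>t * (\<Sum>i. w i * v (n + i))\<close>, so that for \<open>p = 0\<close> the
  bilinear exponent fails to be a cocycle.  The terms with \<open>tri\<close> repair this if \<open>n = 1\<close>; they are
  periodic modulo \<open>r\<close> only for odd \<open>r\<close>.  If \<open>n > 1\<close>, all exponents with \<open>p = 0\<close> matter only modulo \<open>t\<close>.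
\<close>

definition std_exp :: "int \<Rightarrow> nat \<Rightarrow> nat \<times> nat \<Rightarrow> (nat \<Rightarrow> int) \<Rightarrow> (nat \<Rightarrow> int) \<Rightarrow> int" where
  "std_exp t n = (\<lambda>(p, q) v w.
    if p = 0 then
      if q \<le> n then - (v 0 * w q + t * (v (n + q) * tri (w q)))
      else v q * w 0 + t * (tri (v q) * w (q - n))
    else if p = 1 \<and> q = n + 1 then \<Sum>i=1..n. v (n + i) * w i
    else v q * w p)"

context heis_chart
begin

text \<open>Differs from \<open>heis_order\<close> only at \<open>(1, n + 1)\<close>: there the
  invariant is the \<open>cofactor\<close>-th power of the inserted root of unity, so an r-th root
  yields a value killed by \<open>nat \<bar>t\<bar>\<close>.\<close>

definition std_order :: "nat \<times> nat \<Rightarrow> nat" where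
  "std_order pq = (if fst pq = 0 then if n = 1 then r else nat \<bar>t\<bar> else r)"

lemma std_order_dvd: "int (std_order pq) dvd int r"
  using t_dvd by (auto simp: std_order_def)

lemma std_exp_cong:
  assumes pq: "(p, q) \<in> heis_index r n" and "P v = P v'" "P w = P w'"
  shows "int (std_order (p, q)) dvd std_exp t n (p, q) v w - std_exp t n (p, q) v' w'"
proof -
  have v: "int r dvd v k - v' k" and w: "int r dvd w k - w' k" if "k \<le> 2 * n" for k
    using assms that by (auto simp: P_eq_iff)
  have q: "p < q" "q \<le> 2 * n" using pq by (auto simp: heis_index_def)
  show ?thesis
  proof (cases "p = 0")
    case False
    have "int r dvd (\<Sum>i=1..n. v (n + i) * w i) - (\<Sum>i=1..n. v' (n + i) * w' i)"
      unfolding sum_subtractf[symmetric] by (intro dvd_sum dvd_diff_mult_cong v w) auto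
    then show ?thesis
      using False q by (auto simp: std_exp_def std_order_def intro!: dvd_diff_mult_cong v w)
  next
    case p: True
    have b1: "int r dvd v 0 * w q - v' 0 * w' q" and b2: "int r dvd v q * w 0 - v' q * w' 0"
      using q by (auto intro!: dvd_diff_mult_cong v w)
    have t1: "int (std_order (p, q)) dvd t * (v (n + q) * tri (w q)) - t * (v' (n + q) * tri (w' q))"
      if "q \<le> n"
    proof (cases "n = 1")
      case True
      then have o: "std_order (p, q) = r" unfolding std_order_def using p by simp
      show ?thesis
        unfolding o right_diff_distrib[symmetric]
        using True that parity p q by (intro dvd_mult dvd_diff_mult_cong tri_cong v w) auto
    next
      case False
      then show ?thesis using p by (simp add: std_order_def right_diff_distrib[symmetric])
    qed
    have t2: "int (std_order (p, q)) dvd t * (tri (v q) * w (q - n)) - t * (tri (v' q) * w' (q - n))"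
    proof (cases "n = 1")
      case True
      then have o: "std_order (p, q) = r" unfolding std_order_def using p by simp
      show ?thesis
        unfolding o right_diff_distrib[symmetric]
        using True parity p q by (intro dvd_mult dvd_diff_mult_cong tri_cong v w) auto
    next
      case False
      then show ?thesis using p by (simp add: std_order_def right_diff_distrib[symmetric])
    qed
    have b1: "int (std_order (p, q)) dvd v 0 * w q - v' 0 * w' q"
      and b2: "int (std_order (p, q)) dvd v q * w 0 - v' q * w' 0"
      using b1 b2 std_order_dvd dvd_trans by blast+
    show ?thesis
    proof (cases "q \<le> n")
      case True
      have eq: "std_exp t n (p, q) v w - std_exp t n (p, q) v' w'
          = - ((v 0 * w q - v' 0 * w' q)
            + (t * (v (n + q) * tri (w q)) - t * (v' (n + q) * tri (w' q))))"
        using True p by (simp add: std_exp_def)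
      show ?thesis
        unfolding eq dvd_minus_iff using b1 t1[OF True] by (rule dvd_add)
    next
      case False
      then have eq: "std_exp t n (p, q) v w - std_exp t n (p, q) v' w'
          = (v q * w 0 - v' q * w' 0)
            + (t * (tri (v q) * w (q - n)) - t * (tri (v' q) * w' (q - n)))"
        using p by (simp add: std_exp_def)
      show ?thesis
        unfolding eq using b2 t2 by (rule dvd_add)
    qed
  qed
qed

text \<open>For \<open>p > 0\<close> the exponent is bilinear in additive coordinates and the
  difference is 0. For \<open>p = 0\<close> and \<open>n = 1\<close> the \<open>tri\<close> terms
  cancel the defect exactly; for \<open>n > 1\<close> the defect is a multiple of
  \<open>t\<close>.\<close>

lemma std_exp_cocycle:
  assumes pq: "(p, q) \<in> heis_index r n"
  shows "int (std_order (p, q)) dvd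
    (std_exp t n (p, q) v w + std_exp t n (p, q) (heis_mult t n v w) u)
    - (std_exp t n (p, q) w u + std_exp t n (p, q) v (heis_mult t n w u))"
proof -
  have q: "p < q" "q \<le> 2 * n" using pq by (auto simp: heis_index_def)
  have sums: "(\<Sum>i=1..n. (v (n + i) + w (n + i)) * u i) = (\<Sum>i=1..n. v (n + i) * u i) + (\<Sum>i=1..n. w (n + i) * u i)"
    "(\<Sum>i=1..n. v (n + i) * (w i + u i)) = (\<Sum>i=1..n. v (n + i) * w i) + (\<Sum>i=1..n. v (n + i) * u i)"
    by (simp_all add: algebra_simps sum.distrib)
  show ?thesis
  proof (cases "p = 0")
    case False
    have m: "heis_mult t n a b k = a k + b k" if "k > 0" for a b k
      using that by (simp add: heis_mult_def)
    have "(\<Sum>i=1..n. heis_mult t n v w (n + i) * u i) = (\<Sum>i=1..n. (v (n + i) + w (n + i)) * u i)"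
      "(\<Sum>i=1..n. v (n + i) * heis_mult t n w u i) = (\<Sum>i=1..n. v (n + i) * (w i + u i))"
      by (auto intro!: sum.cong simp: m)
    then show ?thesis
      using False q by (auto simp: std_exp_def m sums algebra_simps)
  next
    case p: True
    show ?thesis
    proof (cases "n = 1")
      case True
      then have "q = 1 \<or> q = 2" using p q by auto
      then show ?thesis
        using p True by (auto simp: std_exp_def heis_mult_def tri_add numeral_2_eq_2 algebra_simps)
    next
      case False
      then show ?thesis
        using p q by (auto simp: std_exp_def std_order_def heis_mult_def tri_add algebra_simps)
    qed
  qed
qed

end

text \<open>All of \<open>\<complex>\<^sup>\<times>\<close> for \<open>k = 0\<close>.\<close>

definition root_group :: "nat \<Rightarrow> complex monoid" where
  "root_group k = complex_units\<lparr>carrier := {u. u \<noteq> 0 \<and> u ^ k = 1}\<rparr>"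

lemma root_group_simps [simp]:
  "carrier (root_group k) = {u. u \<noteq> 0 \<and> u ^ k = 1}"
  "x \<otimes>\<^bsub>root_group k\<^esub> y = x * y" "\<one>\<^bsub>root_group k\<^esub> = 1"
  by (simp_all add: root_group_def complex_units_def)

lemma group_root_group: "group (root_group k)"
proof (rule groupI)
  fix x assume "x \<in> carrier (root_group k)"
  then show "\<exists>y\<in>carrier (root_group k). y \<otimes>\<^bsub>root_group k\<^esub> x = \<one>\<^bsub>root_group k\<^esub>"
    by (intro bexI[of _ "inverse x"]) (auto simp: power_inverse)
qed (auto simp: power_mult_distrib)

lemma finite_heis_index: "finite (heis_index r n)"
  by (rule finite_subset[of _ "{..2 * n} \<times> {..2 * n}"]) (auto simp: heis_index_def)

lemma comm_inv_powi:
  "\<zeta> \<noteq> 0 \<Longrightarrow> comm_inv (\<lambda>v w. \<zeta> powi e v w) p q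
    = \<zeta> powi (e (single q 1) (single p 1) - e (single p 1) (single q 1))"
  by (simp add: comm_inv_def power_int_diff)

lemma dual_inv_powi:
  "\<zeta> \<noteq> 0 \<Longrightarrow> dual_inv t n (\<lambda>v w. \<zeta> powi e v w) i
    = \<zeta> powi (e (single (n + i) 1) (single i 1) - e (single i 1) (single (n + i) 1)
        - e (single 0 t) ((single i 1)(n + i := 1)))"
  by (simp add: dual_inv_def power_int_diff power_int_add)

context heis_chart
begin

text \<open>The \<open>tri\<close> terms vanish at the arguments 0 and 1, and the minus sign in
  \<open>std_exp\<close> for \<open>q \<le> n\<close> makes the diagonal value 1 instead of
  -1.\<close>

lemma std_exp_comm:
  assumes "(a, b) \<in> heis_index r n" "p < q" "q \<le> 2 * n" "\<not> (p > 0 \<and> q = n + p)"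
  shows "std_exp t n (a, b) (single q 1) (single p 1) - std_exp t n (a, b) (single p 1) (single q 1)
    = (if (a, b) = (p, q) then 1 else 0)"
proof -
  have sum: "(\<Sum>i=1..n. single x 1 (n + i) * single y 1 i) = (if y > 0 \<and> y \<le> n \<and> x = n + y then 1 else 0)" for x y
    using sum_single[of y 1 "single x 1" n] by (auto simp: mult.commute single_apply)
  show ?thesis
    unfolding std_exp_def prod.case sum
    using assms by (auto simp: heis_index_def single_apply)
qed

text \<open>The exponent attached to \<open>(1, n + 1)\<close> affects all \<open>C i\<close>
  equally, so it cancels in their quotients and shows only in \<open>central_inv\<close>.\<close>

lemma std_exp_dual:
  assumes "(a, b) \<in> heis_index r n" "i > 0" "i \<le> n"
  shows "std_exp t n (a, b) (single (n + i) 1) (single i 1)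
      - std_exp t n (a, b) (single i 1) (single (n + i) 1)
      - std_exp t n (a, b) (single 0 t) ((single i 1)(n + i := 1))
    = (if a = 0 then if b = i then t else 0
       else if (a, b) = (1, n + 1) \<or> (a, b) = (i, n + i) then 1 else 0)"
proof -
  have sum: "(\<Sum>i=1..n. single x 1 (n + i) * single y 1 i) = (if y > 0 \<and> y \<le> n \<and> x = n + y then 1 else 0)" for x y
    using sum_single[of y 1 "single x 1" n] by (auto simp: mult.commute single_apply)
  have sum0: "(\<Sum>i=1..n. single 0 t (n + i) * w i) = 0" for w
    by (rule sum.neutral) (use n_pos in \<open>auto simp: single_apply\<close>)
  show ?thesis
    unfolding std_exp_def prod.case sum sum0
    using assms by (auto simp: heis_index_def single_apply)
qed

lemma std_exp_central:
  assumes "(a, b) \<in> heis_index r n"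
  shows "std_exp t n (a, b) (single 0 x) (single 0 y) = 0"
proof -
  have "(\<Sum>i=1..n. single 0 x (n + i) * single 0 y i) = 0"
    by (rule sum.neutral) (auto simp: single_apply)
  then show ?thesis
    using assms by (auto simp: std_exp_def heis_index_def single_apply)
qed

text \<open>The matrix of invariants of the standard cocycles is diagonal, so each invariant can be
  prescribed separately.\<close>

lemma heis_inv_std:
  assumes ab: "(a, b) \<in> heis_index r n" and pq: "(p, q) \<in> heis_index r n"
    and \<zeta>: "\<zeta> \<noteq> 0" "\<zeta> ^ std_order (a, b) = 1"
  shows "heis_inv r t n (\<lambda>v w. \<zeta> powi std_exp t n (a, b) v w) (p, q)
    = (if (a, b) \<noteq> (p, q) then 1 else if p = 1 \<and> q = n + 1 then \<zeta> ^ cofactor else \<zeta>)"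
proof -
  let ?F = "\<lambda>v w. \<zeta> powi std_exp t n (a, b) v w"
  have pq': "p < q" "q \<le> 2 * n" using pq by (auto simp: heis_index_def)
  have dual: "dual_inv t n ?F i = \<zeta> powi (if a = 0 then if b = i then t else 0
       else if (a, b) = (1, n + 1) \<or> (a, b) = (i, n + i) then 1 else 0)" if "i > 0" "i \<le> n" for i
    unfolding dual_inv_powi[OF \<zeta>(1)] std_exp_dual[OF ab that] ..
  have \<zeta>t: "\<zeta> powi t = 1" if "a = 0" "n > 1"
    using powi_cong[of \<zeta> "nat \<bar>t\<bar>" t 0] \<zeta> that by (simp add: std_order_def)
  show ?thesis
  proof (cases "p > 0 \<and> q = n + p")
    case False
    then have "heis_inv r t n ?F (p, q) = comm_inv ?F p q" by (auto simp: heis_inv_def)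
    also have "\<dots> = (if (a, b) = (p, q) then \<zeta> else 1)"
      unfolding comm_inv_powi[OF \<zeta>(1)] std_exp_comm[OF ab pq' False] by auto
    finally show ?thesis using False by auto
  next
    case True
    then have p: "p > 0" "p \<le> n" "q = n + p" using pq' by auto
    show ?thesis
    proof (cases "p = 1")
      case False
      then have "n > 1" using p by simp
      have "heis_inv r t n ?F (p, q) = dual_inv t n ?F p / dual_inv t n ?F 1"
        using p False by (simp add: heis_inv_def)
      also have "\<dots> = (if (a, b) = (p, q) then \<zeta> else 1)"
        using dual[OF p(1,2)] dual[of 1] p False \<zeta> \<zeta>t \<open>n > 1\<close> by auto
      finally show ?thesis using False by auto
    next
      case True
      have "heis_inv r t n ?F (p, q) = central_inv t n cofactor ?F"
        using p True by (simp add: heis_inv_def cofactor_def)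
      also have "\<dots> = dual_inv t n ?F 1 ^ cofactor"
        by (simp add: central_inv_def std_exp_central[OF ab])
      also have "\<dots> = (if (a, b) = (1, n + 1) then \<zeta> ^ cofactor else 1)"
      proof (cases "a = 0 \<and> b = 1")
        case True
        \<comment> \<open>The stray exponent \<open>t\<close> from \<open>std_exp_dual\<close> is
          harmless: for \<open>n > 1\<close> already \<open>\<zeta> powi t = 1\<close>, and for
          \<open>n = 1\<close> the product \<open>t * int cofactor\<close> is a multiple of
          \<open>r\<close>.\<close>
        have "(\<zeta> powi t) ^ cofactor = 1"
        proof (cases "n = 1")
          case False
          then show ?thesis using \<zeta>t True n_pos by simp
        next
          case n1: True
          have "std_order (a, b) = r"
            unfolding std_order_def using True n1 by simp
          then have "\<zeta> powi (t * int cofactor) = \<zeta> powi 0"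
            using \<zeta> dvd_cofactor by (intro powi_cong[of _ r]) simp_all
          then show ?thesis by (simp add: power_int_mult)
        qed
        then show ?thesis using dual[of 1] n_pos True by simp
      next
        case False
        then show ?thesis using dual[of 1] n_pos by auto
      qed
      finally show ?thesis using True p by auto
    qed
  qed
qed

text \<open>A product of standard cocycles over all pairs works, the scalar at
  \<open>(1, n + 1)\<close> being a \<open>cofactor\<close>-th root of the prescribed value.\<close>

lemma heis_inv_surj:
  assumes \<zeta>: "\<And>pq. pq \<in> heis_index r n \<Longrightarrow> \<zeta> pq \<noteq> 0 \<and> \<zeta> pq ^ heis_order r t n pq = 1"
  obtains f where "f \<in> cocycles2 G complex_units"
    "\<And>pq. pq \<in> heis_index r n \<Longrightarrow> heis_inv r t n (\<lambda>v w. f (P v, P w)) pq = \<zeta> pq"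
proof -
  let ?I = "heis_index r n"
  have "\<exists>x. x \<noteq> 0 \<and> x ^ std_order pq = 1 \<and> (if pq = (1, n + 1) then x ^ cofactor else x) = \<zeta> pq"
    if pq: "pq \<in> ?I" for pq
  proof (cases "pq = (1, n + 1)")
    case True
    then have "r > 0" using pq by (auto simp: heis_index_def)
    then have "cofactor > 0" using cofactor_times by (metis mult_0 neq0_conv)
    then obtain x where x: "x \<noteq> 0" "x ^ cofactor = \<zeta> pq"
      using complex_root_exists \<zeta>[OF pq] by blast
    have "x ^ r = (x ^ cofactor) ^ nat \<bar>t\<bar>"
      by (simp only: power_mult[symmetric] cofactor_times)
    also have "\<dots> = 1"
      using \<zeta>[OF pq] x True by (simp add: heis_order_def)
    finally show ?thesis using x True by (auto simp: std_order_def)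
  next
    case False
    then have "heis_order r t n pq = std_order pq"
      by (auto simp: heis_order_def std_order_def split: prod.split)
    then show ?thesis using \<zeta>[OF pq] False by auto
  qed
  then obtain x where x: "\<And>pq. pq \<in> ?I \<Longrightarrow>
      x pq \<noteq> 0 \<and> x pq ^ std_order pq = 1 \<and> (if pq = (1, n + 1) then x pq ^ cofactor else x pq) = \<zeta> pq"
    by metis
  define F where "F v w = (\<Prod>pq\<in>?I. x pq powi std_exp t n pq v w)" for v w
  have powi: "x pq powi c = x pq powi d" if "pq \<in> ?I" "int (std_order pq) dvd c - d" for c d pq
    using powi_cong x[OF that(1)] that(2) by blast
  obtain f where f: "f \<in> cocycles2 G complex_units" "\<And>v w. f (P v, P w) = F v w"
  proof (rule cocycle_of_chart[of F])
    show "F v w \<noteq> 0" for v w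
      using x by (simp add: F_def finite_heis_index)
    show "F v w = F v' w'" if "P v = P v'" "P w = P w'" for v w v' w'
      unfolding F_def
    proof (rule prod.cong[OF refl])
      fix pq assume "pq \<in> ?I"
      then show "x pq powi std_exp t n pq v w = x pq powi std_exp t n pq v' w'"
        using that by (cases pq) (auto intro!: powi std_exp_cong)
    qed
    show "F v w * F (heis_mult t n v w) u = F w u * F v (heis_mult t n w u)" for v w u
      unfolding F_def prod.distrib[symmetric]
    proof (rule prod.cong[OF refl])
      fix pq assume pq: "pq \<in> ?I"
      have "x pq powi (std_exp t n pq v w + std_exp t n pq (heis_mult t n v w) u)
          = x pq powi (std_exp t n pq w u + std_exp t n pq v (heis_mult t n w u))"
        using pq std_exp_cocycle[of "fst pq" "snd pq" v w u] by (intro powi) auto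
      then show "x pq powi std_exp t n pq v w * x pq powi std_exp t n pq (heis_mult t n v w) u
          = x pq powi std_exp t n pq w u * x pq powi std_exp t n pq v (heis_mult t n w u)"
        using x[OF pq] by (simp add: power_int_add)
    qed
  qed blast
  have "heis_inv r t n (\<lambda>v w. f (P v, P w)) pq = \<zeta> pq" if pq: "pq \<in> ?I" for pq
  proof -
    have "heis_inv r t n (\<lambda>v w. f (P v, P w)) pq
        = (\<Prod>ab\<in>?I. heis_inv r t n (\<lambda>v w. x ab powi std_exp t n ab v w) pq)"
      unfolding f F_def heis_inv_prod[OF finite_heis_index] ..
    also have "\<dots> = (\<Prod>ab\<in>?I. if ab = pq then \<zeta> pq else 1)"
    proof (rule prod.cong[OF refl])
      fix ab assume ab: "ab \<in> ?I"
      obtain a b p q where *: "ab = (a, b)" "pq = (p, q)" by (metis surj_pair)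
      show "heis_inv r t n (\<lambda>v w. x ab powi std_exp t n ab v w) pq = (if ab = pq then \<zeta> pq else 1)"
        using heis_inv_std[of a b p q "x ab"] x[OF ab] ab pq by (auto simp: *)
    qed
    also have "\<dots> = \<zeta> pq" using pq by (simp add: finite_heis_index)
    finally show ?thesis .
  qed
  with f(1) show ?thesis using that by blast
qed

text \<open>First isomorphism theorem for the homomorphism \<open>h\<close> collecting all
  invariants: \<open>heis_inv_surj\<close> gives surjectivity, and the kernel consists of the
  coboundaries.\<close>

theorem cohomology2_heis:
  "cohomology2 G complex_units
    \<cong> product_group (heis_index r n) (\<lambda>pq. root_group (heis_order r t n pq))"
proof -
  let ?Z = "(cochains2 G complex_units)\<lparr>carrier := cocycles2 G complex_units\<rparr>"
  let ?I = "heis_index r n"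
  let ?R = "product_group ?I (\<lambda>pq. root_group (heis_order r t n pq))"
  define h where "h f = (\<lambda>pq\<in>?I. heis_inv r t n (\<lambda>v w. f (P v, P w)) pq)" for f
  interpret Z: group ?Z
    using comm_group.axioms(2)[OF comm_group_cochains2[OF comm_group_complex_units]]
      subgroup_cocycles2[OF group_axioms comm_group_complex_units]
    by (rule group.subgroup_imp_group)
  interpret R: group ?R
    by (simp add: group_root_group)
  have cocycle: "heis_cocycle G P r t n f" if "f \<in> cocycles2 G complex_units" for f
    using that by unfold_locales
  have h_closed: "h f \<in> carrier ?R" if "f \<in> cocycles2 G complex_units" for f
  proof -
    interpret heis_cocycle G P r t n f using that by (rule cocycle)
    have "heis_inv r t n F pq \<noteq> 0" for pq
      using K_nonzero comm_inv_nonzero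
      by (auto simp: heis_inv_def central_inv_def K_def split: prod.split)
    then show ?thesis using heis_inv_order by (auto simp: h_def)
  qed
  interpret h: group_hom ?Z ?R h
  proof unfold_locales
    show "h \<in> hom ?Z ?R"
    proof (rule homI)
      fix f f' assume *: "f \<in> carrier ?Z" "f' \<in> carrier ?Z"
      show "h (f \<otimes>\<^bsub>?Z\<^esub> f') = h f \<otimes>\<^bsub>?R\<^esub> h f'"
        by (auto simp: h_def cochains2_def heis_inv_mult[symmetric])
    qed (use h_closed in simp)
  qed
  have "h ` carrier ?Z = carrier ?R"
  proof (intro equalityI subsetI)
    fix \<zeta> assume \<zeta>: "\<zeta> \<in> carrier ?R"
    then obtain f where f: "f \<in> cocycles2 G complex_units"
      "\<And>pq. pq \<in> ?I \<Longrightarrow> heis_inv r t n (\<lambda>v w. f (P v, P w)) pq = \<zeta> pq"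
      using heis_inv_surj[of \<zeta>] by (auto simp: PiE_iff)
    then have "h f = \<zeta>"
      using \<zeta> by (auto simp: h_def fun_eq_iff PiE_iff extensional_def)
    then show "\<zeta> \<in> h ` carrier ?Z" using f(1) by auto
  next
    fix \<zeta> assume "\<zeta> \<in> h ` carrier ?Z"
    then obtain f where "f \<in> cocycles2 G complex_units" "\<zeta> = h f" by auto
    then show "\<zeta> \<in> carrier ?R" using h_closed by blast
  qed
  moreover have "kernel ?Z ?R h = coboundaries2 G complex_units"
  proof (intro equalityI subsetI)
    fix f assume "f \<in> kernel ?Z ?R h"
    then have f: "f \<in> cocycles2 G complex_units" and hf: "h f = \<one>\<^bsub>?R\<^esub>"
      by (auto simp: kernel_def)
    interpret heis_cocycle G P r t n f using f by (rule cocycle)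
    show "f \<in> coboundaries2 G complex_units"
    proof (rule heis_inv_trivial_imp_coboundary)
      fix p q assume "(p, q) \<in> ?I"
      then show "heis_inv r t n F (p, q) = 1"
        using fun_cong[OF hf, of "(p, q)"] by (simp add: h_def)
    qed
  next
    fix f assume f: "f \<in> coboundaries2 G complex_units"
    then have "f \<in> cocycles2 G complex_units"
      using subgroup.subset[OF subgroup_coboundaries2[OF group_axioms comm_group_complex_units]]
      by auto
    moreover have "h f = \<one>\<^bsub>?R\<^esub>"
      using coboundary_imp_heis_inv_trivial[OF f] by (auto simp: h_def)
    ultimately show "f \<in> kernel ?Z ?R h"
      by (simp add: kernel_def)
  qed
  ultimately show ?thesis
    using h.FactGroup_iso by (simp add: cohomology2_def)
qed

end

subsection \<open>Powers of groups and roots of unity\<close>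

lemma group_add_monoid: "cring R \<Longrightarrow> group (add_monoid R)"
  by (intro abelian_group.a_group ring.is_abelian_group cring.axioms(1))

lemma group_int_quot: "group (int_quot k)"
  using ZFact_is_cring by (rule group_add_monoid)

text \<open>First isomorphism theorem for the powers of a primitive root of unity \<open>g\<close>
  of order \<open>nat \<bar>t\<bar>\<close>; the kernel is the ideal generated by
  \<open>t\<close>.\<close>

lemma root_group_iso_int_quot:
  assumes "t \<noteq> 0" shows "root_group (nat \<bar>t\<bar>) \<cong> int_quot t"
proof -
  let ?k = "nat \<bar>t\<bar>" and ?A = "add_monoid \<Z>"
  have k: "?k > 0" using assms by simp
  define g where "g = cis (2 * pi / real ?k)"
  have g: "g \<noteq> 0" by (simp add: g_def)
  have pow: "g ^ i = cis (2 * pi * real i / real ?k)" for i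
    by (simp add: g_def DeMoivre algebra_simps)
  have bij: "bij_betw (\<lambda>i. g ^ i) {..<?k} {z. z ^ ?k = 1}"
    unfolding pow using bij_betw_roots_unity[OF k] .
  have gk: "g ^ ?k = 1"
    using k by (simp add: pow)
  interpret h: group_hom ?A "root_group ?k" "\<lambda>j. g powi j"
  proof (rule group_hom.intro)
    show "group ?A" using int.is_cring by (rule group_add_monoid)
    show "group_hom_axioms ?A (root_group ?k) (\<lambda>j. g powi j)"
    proof
      have "(g powi j) ^ ?k = 1" for j
        by (metis gk mult.commute power_int_1_left power_int_mult power_int_of_nat)
      then show "(\<lambda>j. g powi j) \<in> hom ?A (root_group ?k)"
        using g by (auto simp: hom_def power_int_add)
    qed
  qed (rule group_root_group)
  have "(\<lambda>j. g powi j) ` carrier ?A = carrier (root_group ?k)"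
  proof (intro equalityI subsetI)
    fix z assume "z \<in> carrier (root_group ?k)"
    then have "z \<in> (\<lambda>i. g ^ i) ` {..<?k}"
      using bij by (auto simp: bij_betw_def)
    then obtain i where "z = g powi int i" by auto
    then show "z \<in> (\<lambda>j. g powi j) ` carrier ?A"
      by (intro image_eqI[of _ _ "int i"]) simp_all
  qed (use h.hom_closed in auto)
  then have "?A Mod kernel ?A (root_group ?k) (\<lambda>j. g powi j) \<cong> root_group ?k"
    by (rule h.FactGroup_iso)
  moreover have "kernel ?A (root_group ?k) (\<lambda>j. g powi j) = Idl\<^bsub>\<Z>\<^esub> {t}"
  proof -
    have "g powi j = 1 \<longleftrightarrow> t dvd j" for j
    proof -
      define i where "i = nat (j mod int ?k)"
      have i: "i < ?k" "int i = j mod int ?k"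
        using k by (auto simp: i_def nat_less_iff)
      have "int ?k dvd j - int i"
        unfolding i(2) by (rule dvd_minus_mod)
      then have "g powi j = g ^ i"
        using powi_cong[OF g gk, of j "int i"] by simp
      then have "g powi j = 1 \<longleftrightarrow> g ^ i = g ^ 0" by simp
      also have "\<dots> \<longleftrightarrow> i = 0"
        by (rule inj_on_eq_iff[OF bij_betw_imp_inj_on[OF bij]]) (use i(1) k in auto)
      also have "\<dots> \<longleftrightarrow> int i = 0" by simp
      also have "\<dots> \<longleftrightarrow> int ?k dvd j"
        unfolding i(2) by (rule dvd_eq_mod_eq_0[symmetric])
      also have "\<dots> \<longleftrightarrow> t dvd j" by simp
      finally show ?thesis .
    qed
    then show ?thesis
      by (auto simp: kernel_def int_Idl mult.commute elim!: dvdE)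
  qed
  moreover have "int_quot t = ?A Mod Idl\<^bsub>\<Z>\<^esub> {t}"
    by (simp add: ZFact_def FactRing_def FactGroup_def A_RCOSETS_def set_add_def)
  ultimately have "int_quot t \<cong> root_group ?k" by simp
  then show ?thesis
    using group.iso_sym[OF group_int_quot] by blast
qed

lemma root_group_zero: "root_group 0 = complex_units"
proof -
  have "{u::complex. u \<noteq> 0 \<and> u ^ 0 = 1} = - {0}" by auto
  then show ?thesis by (simp add: root_group_def complex_units_def)
qed

lemma product_group_Un_iso:
  assumes "A \<inter> B = {}"
  shows "product_group (A \<union> B) G \<cong> product_group A G \<times>\<times> product_group B G"
proof (rule is_isoI, rule isoI)
  let ?h = "\<lambda>x. (restrict x A, restrict x B)"
  show "?h \<in> hom (product_group (A \<union> B) G) (product_group A G \<times>\<times> product_group B G)"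
    by (auto simp: hom_def fun_eq_iff DirProd_def)
  show "bij_betw ?h (carrier (product_group (A \<union> B) G)) (carrier (product_group A G \<times>\<times> product_group B G))"
    by (rule bij_betw_byWitness[where f' = "\<lambda>(x, y). \<lambda>i\<in>A \<union> B. if i \<in> A then x i else y i"])
      (use assms in \<open>auto simp: fun_eq_iff PiE_iff extensional_def\<close>)
qed

lemma product_group_reindex_iso:
  assumes \<sigma>: "bij_betw \<sigma> J I"
  shows "product_group I G \<cong> product_group J (\<lambda>j. G (\<sigma> j))"
proof (rule is_isoI, rule isoI)
  let ?h = "\<lambda>x. \<lambda>j\<in>J. x (\<sigma> j)"
  have mem: "\<sigma> j \<in> I" if "j \<in> J" for j using \<sigma> that by (auto simp: bij_betw_def)
  show "?h \<in> hom (product_group I G) (product_group J (\<lambda>j. G (\<sigma> j)))"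
    by (auto simp: hom_def fun_eq_iff mem)
  have inv: "inv_into J \<sigma> i \<in> J" "\<sigma> (inv_into J \<sigma> i) = i" if "i \<in> I" for i
    using \<sigma> that by (auto simp: bij_betw_def inv_into_into f_inv_into_f)
  have inv': "inv_into J \<sigma> (\<sigma> j) = j" if "j \<in> J" for j
    using \<sigma> that by (auto simp: bij_betw_def)
  show "bij_betw ?h (carrier (product_group I G)) (carrier (product_group J (\<lambda>j. G (\<sigma> j))))"
  proof (rule bij_betw_byWitness[where f' = "\<lambda>y. \<lambda>i\<in>I. y (inv_into J \<sigma> i)"])
    show "(\<lambda>y. \<lambda>i\<in>I. y (inv_into J \<sigma> i)) ` carrier (product_group J (\<lambda>j. G (\<sigma> j)))
        \<subseteq> carrier (product_group I G)"
      using inv by (fastforce simp: PiE_iff)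
  qed (auto simp: fun_eq_iff PiE_iff extensional_def inv inv' mem)
qed

lemma product_group_iso_power:
  assumes "finite I" and iso: "\<And>i. i \<in> I \<Longrightarrow> G i \<cong> A"
    and "\<And>i. i \<in> I \<Longrightarrow> group (G i)" "group A"
  shows "product_group I G \<cong> group_power A (card I)"
proof -
  obtain \<sigma> where \<sigma>: "bij_betw \<sigma> {..<card I} I"
    using ex_bij_betw_nat_finite[OF \<open>finite I\<close>] by (auto simp: lessThan_atLeast0)
  then have mem: "\<sigma> j \<in> I" if "j < card I" for j using that by (auto simp: bij_betw_def)
  have "product_group I G \<cong> product_group {..<card I} (\<lambda>j. G (\<sigma> j))"
    using \<sigma> by (rule product_group_reindex_iso)
  also have "\<dots> \<cong> product_group {..<card I} (\<lambda>_. A)"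
    by (rule iso_product_groupI) (use assms mem in auto)
  finally show ?thesis by (simp add: group_power_def)
qed

lemma product_group_iso_powers:
  assumes "finite I" "finite J" "I \<inter> J = {}"
    and "\<And>i. i \<in> I \<Longrightarrow> G i \<cong> A" "\<And>j. j \<in> J \<Longrightarrow> G j \<cong> B"
    and "\<And>i. i \<in> I \<union> J \<Longrightarrow> group (G i)" "group A" "group B"
  shows "product_group (I \<union> J) G \<cong> group_power A (card I) \<times>\<times> group_power B (card J)"
proof -
  have "product_group (I \<union> J) G \<cong> product_group I G \<times>\<times> product_group J G"
    by (rule product_group_Un_iso) fact
  also have "\<dots> \<cong> group_power A (card I) \<times>\<times> group_power B (card J)"
    by (intro group.DirProd_iso_trans product_group product_group_iso_power) (use assms in auto)
  finally show ?thesis .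
qed

lemma group_group_power: "group A \<Longrightarrow> group (group_power A k)"
  by (simp add: group_power_def)

lemma group_power_one: "group_power A 1 \<cong> A"
proof (rule is_isoI, rule isoI)
  show "(\<lambda>x. x 0) \<in> hom (group_power A 1) A"
    by (auto simp: hom_def group_power_def)
  show "bij_betw (\<lambda>x. x 0) (carrier (group_power A 1)) (carrier A)"
    by (rule bij_betw_byWitness[where f' = "\<lambda>a. \<lambda>i\<in>{..<1}. a"])
      (auto simp: group_power_def fun_eq_iff PiE_iff extensional_def split: if_splits)
qed

section \<open>Integral coordinates on the Heisenberg group over the integers modulo r\<close>

definition heis_point :: "nat \<Rightarrow> nat \<Rightarrow> (nat \<Rightarrow> int) \<Rightarrow> int set \<times> (nat \<Rightarrow> int set) \<times> (nat \<Rightarrow> int set)"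
  where "heis_point r n v = (ZMod (int r) (v 0),
    \<lambda>i\<in>{1..n}. ZMod (int r) (v i), \<lambda>i\<in>{1..n}. ZMod (int r) (v (n + i)))"

lemma ZMod_ring_hom: "ZMod k \<in> ring_hom \<Z> (ZFact k)"
proof -
  have "(+>\<^bsub>\<Z>\<^esub>) (Idl\<^bsub>\<Z>\<^esub> {k}) \<in> ring_hom \<Z> (\<Z> Quot Idl\<^bsub>\<Z>\<^esub> {k})"
    by (intro ideal.rcos_ring_hom int.genideal_ideal) simp
  moreover have "(+>\<^bsub>\<Z>\<^esub>) (Idl\<^bsub>\<Z>\<^esub> {k}) = ZMod k"
    by (simp add: ZMod_def fun_eq_iff)
  ultimately show ?thesis
    by (simp add: ZFact_def)
qed

lemma carrier_ZFact: "carrier (ZFact k) = range (ZMod k)"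
  by (auto simp: ZFact_def FactRing_def A_RCOSETS_def' ZMod_def)

lemma ZMod_closed: "ZMod k a \<in> carrier (ZFact k)"
  by (simp add: carrier_ZFact)

lemma ZMod_add: "ZMod k a \<oplus>\<^bsub>ZFact k\<^esub> ZMod k b = ZMod k (a + b)"
  using ring_hom_add[OF ZMod_ring_hom, of a b k] by simp

lemma ZMod_mult: "ZMod k a \<otimes>\<^bsub>ZFact k\<^esub> ZMod k b = ZMod k (a * b)"
  using ring_hom_mult[OF ZMod_ring_hom, of a b k] by simp

lemma ZMod_finsum: "(\<Oplus>\<^bsub>ZFact k\<^esub>i\<in>A. ZMod k (s i)) = ZMod k (\<Sum>i\<in>A. s i)"
proof -
  interpret ring_hom_cring \<Z> "ZFact k" "ZMod k"
    using int.is_cring ZFact_is_cring ZMod_ring_hom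
    by (simp add: ring_hom_cring_def ring_hom_cring_axioms_def)
  show ?thesis
    using hom_finsum[of s A] by (simp add: o_def int_finsum_eq)
qed

lemma heis_chart_heisenberg_group:
  assumes "n > 0" "t \<noteq> 0" "t dvd int r" "n > 1 \<or> odd r \<or> r = 0"
  shows "heis_chart (heisenberg_group (ZFact (int r)) (ZMod (int r) t) n) (heis_point r n) r t n"
proof -
  let ?R = "ZFact (int r)" and ?q = "ZMod (int r)"
  let ?H = "heisenberg_group ?R (?q t) n"
  note q = ZMod_closed ZMod_add ZMod_mult ZMod_finsum
  interpret H: group ?H
    using ZFact_is_cring ZMod_closed by (rule group_heisenberg_group)
  show ?thesis
  proof unfold_locales
    have "heis_point r n v \<in> carrier ?H" for v
      by (auto simp: heis_point_def heisenberg_group_def q)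
    moreover have "x \<in> range (heis_point r n)" if "x \<in> carrier ?H" for x
    proof -
      obtain a b c where x: "x = (a, b, c)" "a \<in> range ?q"
        "b \<in> (\<Pi>\<^sub>E i\<in>{1..n}. range ?q)" "c \<in> (\<Pi>\<^sub>E i\<in>{1..n}. range ?q)"
        using \<open>x \<in> carrier ?H\<close> by (auto simp: heisenberg_group_def carrier_ZFact)
      define s where "s y = (SOME j. ?q j = y)" for y
      have s: "?q (s y) = y" if "y \<in> range ?q" for y
        unfolding s_def using that by (intro someI_ex[of "\<lambda>j. ?q j = y"]) auto
      define v where "v k = (if k = 0 then s a else if k \<le> n then s (b k) else s (c (k - n)))" for k
      have "(\<lambda>i\<in>{1..n}. ?q (v i)) = b"
        by (rule extensionalityI[of _ "{1..n}"]) (use x(3) s[OF PiE_mem[OF x(3)]] in \<open>auto simp: v_def PiE_def\<close>)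
      moreover have "(\<lambda>i\<in>{1..n}. ?q (v (n + i))) = c"
        by (rule extensionalityI[of _ "{1..n}"]) (use x(4) s[OF PiE_mem[OF x(4)]] in \<open>auto simp: v_def PiE_def\<close>)
      ultimately have "heis_point r n v = x"
        using s[OF x(2)] by (simp add: heis_point_def v_def x(1))
      then show ?thesis by (metis rangeI)
    qed
    ultimately show "carrier ?H = range (heis_point r n)" by auto
    show "heis_point r n v \<otimes>\<^bsub>?H\<^esub> heis_point r n w = heis_point r n (heis_mult t n v w)" for v w
    proof -
      have "(\<Oplus>\<^bsub>?R\<^esub>i\<in>{1..n}. (\<lambda>i\<in>{1..n}. ?q (w i)) i \<otimes>\<^bsub>?R\<^esub> (\<lambda>i\<in>{1..n}. ?q (v (n + i))) i)
          = (\<Oplus>\<^bsub>?R\<^esub>i\<in>{1..n}. ?q (w i * v (n + i)))"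
        by (rule abelian_monoid.finsum_cong'[OF abelian_group.axioms(1)
              [OF ring.is_abelian_group[OF cring.axioms(1)[OF ZFact_is_cring]]] refl]) (auto simp: q)
      then show ?thesis
        by (auto simp: heis_point_def heisenberg_group_def heis_mult_def fun_eq_iff q)
    qed
    show "heis_point r n v = heis_point r n w \<longleftrightarrow> (\<forall>k\<le>2 * n. int r dvd v k - w k)" for v w
    proof -
      have q_eq: "?q a = ?q b \<longleftrightarrow> int r dvd a - b" for a b
        by (simp add: ZMod_eq_mod mod_eq_dvd_iff)
      have "heis_point r n v = heis_point r n w \<longleftrightarrow> int r dvd v 0 - w 0
          \<and> (\<forall>i\<in>{1..n}. int r dvd v i - w i) \<and> (\<forall>i\<in>{1..n}. int r dvd v (n + i) - w (n + i))"
        by (auto simp: heis_point_def fun_eq_iff q_eq)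
      also have "\<dots> \<longleftrightarrow> (\<forall>k\<le>2 * n. int r dvd v k - w k)"
      proof (intro iffI allI impI)
        fix k
        assume *: "int r dvd v 0 - w 0 \<and> (\<forall>i\<in>{1..n}. int r dvd v i - w i)
          \<and> (\<forall>i\<in>{1..n}. int r dvd v (n + i) - w (n + i))" and "k \<le> 2 * n"
        then consider "k = 0" | "k \<in> {1..n}" | "k - n \<in> {1..n}" "k = n + (k - n)" by fastforce
        then show "int r dvd v k - w k"
          using * by cases metis+
      qed auto
      finally show ?thesis .
    qed
  qed (use assms in auto)
qed

section \<open>Counting pairs of generators and assembling the factors\<close>

lemma card_pos_pairs: "card {(p, q). 0 < p \<and> p < q \<and> q \<le> m} = m * (m - 1) div 2"
proof -
  have "2 * card {(p, q). 0 < p \<and> p < q \<and> q \<le> m} = m * (m - 1)"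
  proof (induction m)
    case 0
    have "{(p, q). 0 < p \<and> p < q \<and> q \<le> (0::nat)} = {}" by auto
    then show ?case by (simp only: card.empty mult_zero_left mult_zero_right)
  next
    case (Suc m)
    let ?T = "\<lambda>m. {(p, q). 0 < p \<and> p < q \<and> q \<le> m}"
    have "?T (Suc m) = ?T m \<union> (\<lambda>p. (p, Suc m)) ` {1..m}"
      by (auto simp: le_Suc_eq image_iff)
    moreover have "finite (?T m)"
      by (rule finite_subset[of _ "{..m} \<times> {..m}"]) auto
    moreover have "?T m \<inter> (\<lambda>p. (p, Suc m)) ` {1..m} = {}" by auto
    moreover have "card ((\<lambda>p. (p, Suc m)) ` {1..m}) = m"
      by (subst card_image) (auto simp: inj_on_def)
    ultimately have "card (?T (Suc m)) = card (?T m) + m"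
      by (simp add: card_Un_disjoint)
    then show ?case using Suc by (cases m) (auto simp: algebra_simps)
  qed
  then show ?thesis by simp
qed

lemma card_zero_pairs: "card {(p::nat, q). p = 0 \<and> p < q \<and> q \<le> m} = m"
proof -
  have "{(p::nat, q). p = 0 \<and> p < q \<and> q \<le> m} = Pair 0 ` {1..m}" by auto
  then show ?thesis by (simp add: card_image inj_on_def)
qed

lemma card_noncentral_pairs:
  assumes "n > 0"
  shows "card ({(p, q). 0 < p \<and> p < q \<and> q \<le> 2 * n} - {(1, n + 1)}) = 2 * n ^ 2 - n - 1"
proof -
  have "(1, n + 1) \<in> {(p, q). 0 < p \<and> p < q \<and> q \<le> 2 * n}" using assms by auto
  then have "card ({(p, q). 0 < p \<and> p < q \<and> q \<le> 2 * n} - {(1, n + 1)}) = 2 * n * (2 * n - 1) div 2 - 1"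
    by (simp only: card_Diff_singleton card_pos_pairs)
  also have "2 * n * (2 * n - 1) div 2 = 2 * n ^ 2 - n"
    by (simp add: power2_eq_square diff_mult_distrib2 mult.assoc)
  finally show ?thesis .
qed

text \<open>The case r = t = 0 is excluded because there the group is free abelian of rank 2n + 1;
  its second cohomology is a power of the nonzero complex numbers with exponent n(2n + 1), which the
  formulas do not give.\<close>

theorem theorem1p1:
  fixes r :: nat and t :: int
  assumes "r > 0 \<Longrightarrow> t dvd int r"
    and "r = 0 \<Longrightarrow> t \<noteq> 0"
  shows "(\<forall>n>1.
      (r > 0 \<longrightarrow>
         cohomology2 (heisenberg_group (ZFact (int r)) (ZMod (int r) t) n) complex_units
         \<cong> group_power (int_quot (int r)) (2 * n ^ 2 - n - 1) \<times>\<times> group_power (int_quot t) (2 * n + 1)) \<and>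
      (r = 0 \<longrightarrow>
         cohomology2 (heisenberg_group (ZFact (int r)) (ZMod (int r) t) n) complex_units
         \<cong> group_power complex_units (2 * n ^ 2 - n - 1) \<times>\<times> group_power (int_quot t) (2 * n)))
    \<and>
      (odd r \<longrightarrow>
         cohomology2 (heisenberg_group (ZFact (int r)) (ZMod (int r) t) 1) complex_units
         \<cong> group_power (int_quot (int r)) 2 \<times>\<times> int_quot t) \<and>
      (r = 0 \<longrightarrow>
         cohomology2 (heisenberg_group (ZFact (int r)) (ZMod (int r) t) 1) complex_units
         \<cong> group_power complex_units 2)"
proof -
  have t: "t \<noteq> 0" "t dvd int r"
    using assms by (cases "r = 0"; fastforce)+
  have root_t: "root_group (nat \<bar>t\<bar>) \<cong> int_quot t"
    using t(1) by (rule root_group_iso_int_quot)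
  have root_r: "root_group r \<cong> int_quot (int r)" if "r > 0"
    using root_group_iso_int_quot[of "int r"] that by simp
  have units: "group complex_units"
    using comm_group_complex_units by (rule comm_group.axioms(2))
  note groups = group_root_group group_int_quot units
  let ?H = "\<lambda>n. cohomology2 (heisenberg_group (ZFact (int r)) (ZMod (int r) t) n) complex_units"
  let ?R = "\<lambda>n pq. root_group (heis_order r t n pq)"
  have main: "?H n \<cong> product_group (heis_index r n) (?R n)"
    if "n > 0" "n > 1 \<or> odd r \<or> r = 0" for n
    using heis_chart.cohomology2_heis[OF heis_chart_heisenberg_group[OF that(1) t that(2)]] .
  \<comment> \<open>\<open>?N\<close> collects the indices of order \<open>r\<close>;
    \<open>?Z\<close> consists of the pairs containing the central generator.\<close>
  let ?N = "\<lambda>n. {(p, q). 0 < p \<and> p < q \<and> q \<le> 2 * n} - {(1, n + 1)}"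
  let ?Z = "\<lambda>n. {(p::nat, q). p = 0 \<and> p < q \<and> q \<le> 2 * n}"
  have finite: "finite (?N n)" "finite (?Z n)" for n
    by (rule finite_subset[of _ "{..2 * n} \<times> {..2 * n}"]; force)+
  have noncentral: "heis_order r t n pq = r" if "pq \<in> ?N n" for n pq
    using that by (auto simp: heis_order_def split: if_splits)
  have central: "heis_order r t n pq = nat \<bar>t\<bar>" if "pq \<in> insert (1, n + 1) (?Z n)" "n > 1" for n pq
    using that by (auto simp: heis_order_def)
  have card_N: "card (?N n) = 2 * n ^ 2 - n - 1" if "n > 1" for n
    using that by (intro card_noncentral_pairs) simp
  have "?H n \<cong> group_power (int_quot (int r)) (2 * n ^ 2 - n - 1) \<times>\<times> group_power (int_quot t) (2 * n + 1)"
    if n: "n > 1" and r: "r > 0" for n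
  proof -
    have "heis_index r n = ?N n \<union> insert (1, n + 1) (?Z n)"
      using n r by (auto simp: heis_index_def)
    then have "?H n \<cong> product_group (?N n \<union> insert (1, n + 1) (?Z n)) (?R n)"
      using main[of n] n by simp
    also have "\<dots> \<cong> group_power (int_quot (int r)) (card (?N n))
        \<times>\<times> group_power (int_quot t) (card (insert (1, n + 1) (?Z n)))"
    proof (rule product_group_iso_powers)
      show "?R n pq \<cong> int_quot (int r)" if "pq \<in> ?N n" for pq
        using noncentral[OF that] root_r[OF r] by simp
      show "?R n pq \<cong> int_quot t" if "pq \<in> insert (1, n + 1) (?Z n)" for pq
        using central[OF that n] root_t by simp
    qed (use finite[of n] groups in auto)
    also have "card (insert (1, n + 1) (?Z n)) = 2 * n + 1"
      using finite(2)[of n] by (simp add: card_zero_pairs)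
    finally show ?thesis unfolding card_N[OF n] .
  qed
  moreover have "?H n \<cong> group_power complex_units (2 * n ^ 2 - n - 1) \<times>\<times> group_power (int_quot t) (2 * n)"
    if n: "n > 1" and r: "r = 0" for n
  proof -
    \<comment> \<open>For \<open>r = 0\<close> the pair \<open>(1, n + 1)\<close> is no index, which
      lowers the exponent of the second factor by one.\<close>
    have "heis_index r n = ?N n \<union> ?Z n"
      using n r by (auto simp: heis_index_def)
    then have "?H n \<cong> product_group (?N n \<union> ?Z n) (?R n)"
      using main[of n] n by simp
    also have "\<dots> \<cong> group_power complex_units (card (?N n)) \<times>\<times> group_power (int_quot t) (card (?Z n))"
    proof (rule product_group_iso_powers)
      show "?R n pq \<cong> complex_units" if "pq \<in> ?N n" for pq
        using noncentral[OF that] r by (simp add: root_group_zero)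
      show "?R n pq \<cong> int_quot t" if "pq \<in> ?Z n" for pq
        using central[of pq n] that n root_t by simp
    qed (use finite[of n] groups in auto)
    finally show ?thesis unfolding card_N[OF n] card_zero_pairs .
  qed
  moreover have "?H 1 \<cong> group_power (int_quot (int r)) 2 \<times>\<times> int_quot t" if r: "odd r"
  proof -
    have "r > 0" using r by (simp add: odd_pos)
    \<comment> \<open>For \<open>n = 1\<close> the pairs with the central generator have order
      \<open>r\<close>, so only \<open>(1, 2)\<close> contributes a factor of order
      \<open>nat \<bar>t\<bar>\<close>.\<close>
    have "heis_index r 1 = {(0, 1), (0, 2)} \<union> {(1, 2)}"
      using \<open>r > 0\<close> by (auto simp: heis_index_def)
    then have "?H 1 \<cong> product_group ({(0, 1), (0, 2)} \<union> {(1, 2)}) (?R 1)"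
      using main[of 1] r by simp
    also have "\<dots> \<cong> group_power (int_quot (int r)) (card {(0::nat, 1::nat), (0, 2)})
        \<times>\<times> group_power (int_quot t) (card {(1::nat, 2::nat)})"
      by (rule product_group_iso_powers)
        (use root_t root_r[OF \<open>r > 0\<close>] groups in \<open>auto simp: heis_order_def\<close>)
    also have "card {(0::nat, 1::nat), (0, 2)} = 2" by simp
    also have "card {(1::nat, 2::nat)} = 1" by simp
    also have "group_power (int_quot (int r)) 2 \<times>\<times> group_power (int_quot t) 1
        \<cong> group_power (int_quot (int r)) 2 \<times>\<times> int_quot t"
      by (intro group.DirProd_iso_trans group_group_power group_int_quot iso_refl group_power_one)
    finally show ?thesis .
  qed
  moreover have "?H 1 \<cong> group_power complex_units 2" if r: "r = 0"
  proof -
    have "heis_index r 1 = {(0, 1), (0, 2)}"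
      using r by (auto simp: heis_index_def)
    then have "?H 1 \<cong> product_group {(0, 1), (0, 2)} (?R 1)"
      using main[of 1] r by simp
    also have "\<dots> \<cong> group_power complex_units (card {(0::nat, 1::nat), (0, 2)})"
      by (rule product_group_iso_power)
        (use r groups in \<open>auto simp: heis_order_def root_group_zero\<close>)
    also have "card {(0::nat, 1::nat), (0, 2)} = 2" by simp
    finally show ?thesis .
  qed
  ultimately show ?thesis by blast
qed

end
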